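(* Let $d>1$ and let $X$ be a finite pure $d$-dimensional simplicial complex which is an $\alpha$-skeleton expander. If $\alpha<(\sqrt[2^d]{2}-1)/\sqrt2$, then for every $0\le i<d$ the high order random walk on dimension $i$ of $X$ is $\mu$-rapidly mixing for $$\mu = 1-\frac{1}{2(d+1)^2}\left(\frac{\sqrt[2^d]{2}-1-\sqrt2\alpha}{2\sqrt2\,d}\right)^{2d}.$$
   Context: A simplicial complex $X$ on a finite vertex set is a family of subsets (faces) closed under taking subsets; it contains $\emptyset$. A face $\sigma$ has dimension $|\sigma|-1$; $X(i)$ is the set of $i$-faces. $X$ is $d$-dimensional if its maximal face dimension is $d$, and pure if every face lies in a $d$-face. $\deg(\sigma)$ is the number of $d$-faces containing $\sigma$. For $W\subseteq X(i)$, $\|W\|=\sum_{\sigma\in W}\deg(\sigma)/\sum_{\tau\in X(i)}\deg(\tau)$. The link of $\sigma$ is $X_\sigma=\{\tau\setminus\sigma:\tau\in X,\tau\supseteq\sigma\}$, a pure complex of dimension $d-|\sigma|$, and $\|\cdot\|_\sigma$ is the norm computed inside $X_\sigma$ (degrees = numbers of top faces of $X_\sigma$). $X$ is an $\alpha$-skeleton expander ($\alpha>0$) if for every face $\sigma\in X$ (including $\sigma=\emptyset$) and every $S\subseteq X_\sigma(0)$, $\|E(S)\|_\sigma\le\|S\|_\sigma(\|S\|_\sigma+\alpha)$, where $E(S)\subseteq X_\sigma(1)$ is the set of edges of $X_\sigma$ with both endpoints in $S$. Two $i$-faces $\sigma\ne\sigma'$ are neighbors ($\sigma\sim\sigma'$)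 if $\sigma\cup\sigma'\in X(i+1)$; $\deg_{G_i}(\sigma)=\sum_{\sigma'\sim\sigma}\deg(\sigma\cup\sigma')$. The high order random walk on dimension $i$ ($1\le i<d$) moves from $\sigma$ to $\sigma'\sim\sigma$ with probability $\deg(\sigma\cup\sigma')/\deg_{G_i}(\sigma)$; for dimension $0$ the walk considered is the lazy version, which stays put with probability $1/2$ and otherwise makes this move. The stationary distribution is $\pi(\sigma)=\deg_{G_i}(\sigma)/\sum_{\rho\in X(i)}\deg_{G_i}(\rho)$. The walk is $\mu$-rapidly mixing ($0<\mu<1$) if for every initial distribution $\pi_0$ on $X(i)$ and every $t\in\mathbb N$, the distribution $\pi_t$ after $t$ steps satisfies $\|\pi_t-\pi\|_2\le\sqrt{d_{\max}/d_{\min}}\,\mu^t$, with $d_{\max},d_{\min}$ the max and min of $\deg_{G_i}$ on $X(i)$. *)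

theory Defs
  imports Complex_Main "HOL-Analysis.L2_Norm"
begin

text \<open>Dimensions are integers, so that the empty face and the link of a top-dimensional
  face have dimension \<open>-1\<close>.  Faces of dimension 0 are the singletons \<open>{v}\<close>.\<close>

definition simplicial_complex :: "'v set \<Rightarrow> 'v set set \<Rightarrow> bool" where
  "simplicial_complex V X \<longleftrightarrow>
     finite V \<and> X \<subseteq> Pow V \<and> {} \<in> X \<and> (\<forall>\<sigma>\<in>X. \<forall>\<tau>. \<tau> \<subseteq> \<sigma> \<longrightarrow> \<tau> \<in> X)"

definition face_dim :: "'v set \<Rightarrow> int" where
  "face_dim \<sigma> = int (card \<sigma>) - 1"

definition faces :: "'v set set \<Rightarrow> int \<Rightarrow> 'v set set" where
  "faces X i = {\<sigma> \<in> X. face_dim \<sigma> = i}"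

definition complex_dim :: "'v set set \<Rightarrow> int" where
  "complex_dim X = Max (face_dim ` X)"

definition pure_complex :: "'v set set \<Rightarrow> bool" where
  "pure_complex X \<longleftrightarrow> (\<forall>\<sigma>\<in>X. \<exists>\<tau>\<in>faces X (complex_dim X). \<sigma> \<subseteq> \<tau>)"

definition face_deg :: "'v set set \<Rightarrow> 'v set \<Rightarrow> nat" where
  "face_deg X \<sigma> = card {\<tau> \<in> faces X (complex_dim X). \<sigma> \<subseteq> \<tau>}"

definition face_norm :: "'v set set \<Rightarrow> int \<Rightarrow> 'v set set \<Rightarrow> real" where
  "face_norm X i W =
     (\<Sum>\<sigma>\<in>W. real (face_deg X \<sigma>)) / (\<Sum>\<tau>\<in>faces X i. real (face_deg X \<tau>))"

definition link :: "'v set set \<Rightarrow> 'v set \<Rightarrow> 'v set set" where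
  "link X \<sigma> = {\<tau> - \<sigma> |\<tau>. \<tau> \<in> X \<and> \<sigma> \<subseteq> \<tau>}"

definition inner_edges :: "'v set set \<Rightarrow> 'v set set \<Rightarrow> 'v set set" where
  "inner_edges X S = {e \<in> faces X 1. \<forall>v\<in>e. {v} \<in> S}"

text \<open>If the link of \<open>\<sigma>\<close> has no edges, the norm of its (empty) set of edges is \<open>0 / 0 = 0\<close>,
  so the inequality imposes no condition at such \<open>\<sigma>\<close>.\<close>

definition skeleton_expander :: "real \<Rightarrow> 'v set set \<Rightarrow> bool" where
  "skeleton_expander \<alpha> X \<longleftrightarrow>
     \<alpha> > 0 \<and>
     (\<forall>\<sigma>\<in>X. \<forall>S. S \<subseteq> faces (link X \<sigma>) 0 \<longrightarrow>
        face_norm (link X \<sigma>) 1 (inner_edges (link X \<sigma>) S)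
          \<le> face_norm (link X \<sigma>) 0 S * (face_norm (link X \<sigma>) 0 S + \<alpha>))"

definition neighbors :: "'v set set \<Rightarrow> int \<Rightarrow> 'v set \<Rightarrow> 'v set set" where
  "neighbors X i \<sigma> = {\<sigma>' \<in> faces X i. \<sigma>' \<noteq> \<sigma> \<and> \<sigma> \<union> \<sigma>' \<in> faces X (i + 1)}"

definition walk_deg :: "'v set set \<Rightarrow> int \<Rightarrow> 'v set \<Rightarrow> real" where
  "walk_deg X i \<sigma> = (\<Sum>\<sigma>'\<in>neighbors X i \<sigma>. real (face_deg X (\<sigma> \<union> \<sigma>')))"

definition move_prob :: "'v set set \<Rightarrow> int \<Rightarrow> 'v set \<Rightarrow> 'v set \<Rightarrow> real" where
  "move_prob X i \<sigma> \<sigma>' =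
     (if \<sigma>' \<in> neighbors X i \<sigma> then real (face_deg X (\<sigma> \<union> \<sigma>')) / walk_deg X i \<sigma> else 0)"

definition walk_prob :: "'v set set \<Rightarrow> int \<Rightarrow> 'v set \<Rightarrow> 'v set \<Rightarrow> real" where
  "walk_prob X i \<sigma> \<sigma>' =
     (if i = 0 then (if \<sigma>' = \<sigma> then 1 / 2 else 0) + 1 / 2 * move_prob X i \<sigma> \<sigma>'
      else move_prob X i \<sigma> \<sigma>')"

definition distribution_on :: "'a set \<Rightarrow> ('a \<Rightarrow> real) \<Rightarrow> bool" where
  "distribution_on A p \<longleftrightarrow> (\<forall>x\<in>A. 0 \<le> p x) \<and> (\<Sum>x\<in>A. p x) = 1"

primrec walk_dist ::
  "'v set set \<Rightarrow> int \<Rightarrow> ('v set \<Rightarrow> real) \<Rightarrow> nat \<Rightarrow> 'v set \<Rightarrow> real" where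
  "walk_dist X i p 0 = p"
| "walk_dist X i p (Suc t) = (\<lambda>\<sigma>'. \<Sum>\<sigma>\<in>faces X i. walk_dist X i p t \<sigma> * walk_prob X i \<sigma> \<sigma>')"

definition stationary :: "'v set set \<Rightarrow> int \<Rightarrow> 'v set \<Rightarrow> real" where
  "stationary X i \<sigma> = walk_deg X i \<sigma> / (\<Sum>\<rho>\<in>faces X i. walk_deg X i \<rho>)"

definition rapidly_mixing :: "real \<Rightarrow> 'v set set \<Rightarrow> int \<Rightarrow> bool" where
  "rapidly_mixing \<mu> X i \<longleftrightarrow>
     0 < \<mu> \<and> \<mu> < 1 \<and>
     (\<forall>p t. distribution_on (faces X i) p \<longrightarrow>
        L2_set (\<lambda>\<sigma>. walk_dist X i p t \<sigma> - stationary X i \<sigma>) (faces X i)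
          \<le> sqrt (Max (walk_deg X i ` faces X i) / Min (walk_deg X i ` faces X i)) * \<mu> ^ t)"

end

theory Submission
  imports Defs
begin

text \<open>Skeleton expansion bounds the conductance of the weighted 1-skeleton of every link from below
  by \<open>h = 1/2 - \<alpha>\<close>, so by Cheeger's inequality all these graphs have spectral gap at least \<open>h\<^sup>2/2\<close>.
  The Dirichlet form of the walk on \<open>k\<close>-element faces is the sum of the Dirichlet forms of the
  1-skeletons of the links of \<open>(k-1)\<close>-element faces, hence it dominates \<open>h\<^sup>2/2\<close> times the Dirichlet
  form of the down-up walk, which has the same gap as the up-down walk one dimension below.
  This local-to-global induction (Alev and Lau) gives the gap \<open>(h\<^sup>2/2)\<^sup>k / k\<close>, which is larger than
  what is claimed.  Eigenvalues never appear: all steps are inequalities between quadratic forms.\<close>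

section \<open>Mixing from bounds on the quadratic form\<close>

text \<open>Completing a square replaces each spectral argument. To turn a two-sided bound on the
  quadratic form of a self-adjoint operator P into a contraction in norm, the form is evaluated at g
  + Pg/\<mu> and g - Pg/\<mu>. To carry a norm bound from the facet-sum operator to its adjoint, the
  square of f - t G is expanded. The divisor k in the gap is a normalisation: a k-element face has k
  facets, so its degree in the walk is k times its degree in the link of any one of them, and the
  induction measures energy against the latter. The 1/2 in h is the largest relative mass of a set
  tested in a cut.\<close>

text \<open>Write P for the operator with \<open>h\<close> = P \<open>g\<close>. Symmetry of
  \<open>c\<close> makes P self-adjoint for \<open>q\<close>, so the form at (\<open>g\<close>, P
  \<open>g\<close>) is the squared norm of P \<open>g\<close>. The upper bound at \<open>g\<close> +
  s P \<open>g\<close> minus the lower bound at \<open>g\<close> - s P \<open>g\<close> isolates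
  this term, and the norms on the right combine by the parallelogram law.\<close>

lemma symmetric_kernel_contraction:
  fixes c :: "'a \<Rightarrow> 'a \<Rightarrow> real" and q g :: "'a \<Rightarrow> real"
  assumes fin: "finite F"
    and sym: "\<And>x y. x \<in> F \<Longrightarrow> y \<in> F \<Longrightarrow> c x y = c y x"
    and row: "\<And>x. x \<in> F \<Longrightarrow> (\<Sum>y\<in>F. c x y) = q x"
    and pos: "\<And>x. x \<in> F \<Longrightarrow> 0 < q x"
    and \<mu>: "0 < \<mu>"
    and form: "\<And>f. (\<Sum>x\<in>F. q x * f x) = 0 \<Longrightarrow>
      \<bar>\<Sum>x\<in>F. \<Sum>y\<in>F. c x y * (f x * f y)\<bar> \<le> \<mu> * (\<Sum>x\<in>F. q x * (f x)\<^sup>2)"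
    and mean: "(\<Sum>x\<in>F. q x * g x) = 0"
  defines "h \<equiv> \<lambda>y. (\<Sum>x\<in>F. c x y * g x) / q y"
  shows "(\<Sum>x\<in>F. q x * h x) = 0"
    and "(\<Sum>x\<in>F. q x * (h x)\<^sup>2) \<le> \<mu>\<^sup>2 * (\<Sum>x\<in>F. q x * (g x)\<^sup>2)"
proof -
  define B where "B f f' = (\<Sum>x\<in>F. \<Sum>y\<in>F. c x y * (f x * f' y))" for f f' :: "'a \<Rightarrow> real"
  define N where "N f = (\<Sum>x\<in>F. q x * (f x)\<^sup>2)" for f :: "'a \<Rightarrow> real"
  have qh: "q y * h y = (\<Sum>x\<in>F. c x y * g x)" if "y \<in> F" for y
    using pos[OF that] by (simp add: h_def)
  have "(\<Sum>x\<in>F. q x * h x) = (\<Sum>y\<in>F. \<Sum>x\<in>F. c x y * g x)"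
    by (rule sum.cong) (simp_all add: qh)
  also have "\<dots> = (\<Sum>x\<in>F. (\<Sum>y\<in>F. c x y) * g x)"
    by (subst sum.swap) (simp add: sum_distrib_right)
  also have "\<dots> = (\<Sum>x\<in>F. q x * g x)"
    by (rule sum.cong) (simp_all add: row)
  finally show meanh: "(\<Sum>x\<in>F. q x * h x) = 0" using mean by simp
  have Bsym: "B h g = B g h"
  proof -
    have "B h g = (\<Sum>y\<in>F. \<Sum>x\<in>F. c x y * (h x * g y))"
      unfolding B_def by (rule sum.swap)
    also have "\<dots> = B g h"
      unfolding B_def by (intro sum.cong refl) (simp add: sym mult.commute)
    finally show ?thesis .
  qed
  have Bgh: "B g h = N h"
  proof -
    have "B g h = (\<Sum>y\<in>F. h y * (\<Sum>x\<in>F. c x y * g x))"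
      unfolding B_def by (subst sum.swap) (simp add: sum_distrib_left mult_ac)
    also have "\<dots> = (\<Sum>y\<in>F. h y * (q y * h y))"
      by (rule sum.cong) (simp_all add: qh)
    finally show ?thesis by (simp add: N_def power2_eq_square mult_ac)
  qed
  \<comment> \<open>This value maximises 4 s - 2 \<mu> s^2, the net coefficient of
    \<open>N h\<close> in the final inequality.\<close>
  define s where "s = 1 / \<mu>"
  define f1 where "f1 x = g x + s * h x" for x
  define f2 where "f2 x = g x - s * h x" for x
  have B1: "B f1 f1 = B g g + 2 * s * N h + s\<^sup>2 * B h h"
  proof -
    have "B f1 f1 = B g g + s * B g h + s * B h g + s\<^sup>2 * B h h"
      by (simp add: B_def f1_def sum_distrib_left sum.distrib[symmetric] algebra_simps power2_eq_square)
    then show ?thesis by (simp add: Bsym Bgh)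
  qed
  have B2: "B f2 f2 = B g g - 2 * s * N h + s\<^sup>2 * B h h"
  proof -
    have "B f2 f2 = B g g - s * B g h - s * B h g + s\<^sup>2 * B h h"
      by (simp add: B_def f2_def sum_distrib_left sum.distrib[symmetric] sum_subtractf[symmetric]
          algebra_simps power2_eq_square)
    then show ?thesis by (simp add: Bsym Bgh)
  qed
  have N12: "N f1 + N f2 = 2 * N g + 2 * s\<^sup>2 * N h"
    by (simp add: N_def f1_def f2_def sum_distrib_left sum.distrib[symmetric] algebra_simps power2_eq_square)
  have m1: "(\<Sum>x\<in>F. q x * f1 x) = 0"
    using mean meanh
    by (simp add: f1_def algebra_simps sum.distrib sum_distrib_left[symmetric])
  have m2: "(\<Sum>x\<in>F. q x * f2 x) = 0"
    using mean meanh
    by (simp add: f2_def algebra_simps sum_subtractf sum_distrib_left[symmetric])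
  have "B f1 f1 \<le> \<mu> * N f1" "- B f2 f2 \<le> \<mu> * N f2"
    using form[OF m1] form[OF m2] by (simp_all add: B_def N_def)
  then have "4 * s * N h \<le> \<mu> * (N f1 + N f2)"
    by (simp add: B1 B2 algebra_simps)
  then have "4 * s * N h \<le> 2 * \<mu> * N g + 2 * (\<mu> * s\<^sup>2) * N h"
    by (simp add: N12 algebra_simps)
  moreover have "\<mu> * s\<^sup>2 = s" using \<mu> by (simp add: s_def power2_eq_square)
  ultimately have "s * N h \<le> \<mu> * N g" by simp
  then have "N h \<le> \<mu>\<^sup>2 * N g"
    using \<mu> by (simp add: s_def field_simps power2_eq_square)
  then show "(\<Sum>x\<in>F. q x * (h x)\<^sup>2) \<le> \<mu>\<^sup>2 * (\<Sum>x\<in>F. q x * (g x)\<^sup>2)"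
    by (simp add: N_def)
qed

text \<open>By symmetry of \<open>c\<close>, the centred density p / q - 1 / Q evolves by the
  contracting operator. Its initial squared norm is at most 1 / Min q, and returning to the
  unweighted norm costs a factor Max q; this is the origin of the prefactor.\<close>

lemma symmetric_kernel_mixing:
  fixes c :: "'a \<Rightarrow> 'a \<Rightarrow> real" and q :: "'a \<Rightarrow> real" and p :: "nat \<Rightarrow> 'a \<Rightarrow> real"
  assumes fin: "finite F"
    and sym: "\<And>x y. x \<in> F \<Longrightarrow> y \<in> F \<Longrightarrow> c x y = c y x"
    and row: "\<And>x. x \<in> F \<Longrightarrow> (\<Sum>y\<in>F. c x y) = q x"
    and pos: "\<And>x. x \<in> F \<Longrightarrow> 0 < q x"
    and \<mu>: "0 < \<mu>"
    and form: "\<And>f. (\<Sum>x\<in>F. q x * f x) = 0 \<Longrightarrow>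
      \<bar>\<Sum>x\<in>F. \<Sum>y\<in>F. c x y * (f x * f y)\<bar> \<le> \<mu> * (\<Sum>x\<in>F. q x * (f x)\<^sup>2)"
    and p0: "distribution_on F (p 0)"
    and step: "\<And>t y. y \<in> F \<Longrightarrow> p (Suc t) y = (\<Sum>x\<in>F. p t x * (c x y / q x))"
  shows "L2_set (\<lambda>x. p t x - q x / (\<Sum>z\<in>F. q z)) F \<le> sqrt (Max (q ` F) / Min (q ` F)) * \<mu> ^ t"
proof -
  have sum0: "(\<Sum>x\<in>F. p 0 x) = 1" and nonneg0: "\<And>x. x \<in> F \<Longrightarrow> 0 \<le> p 0 x"
    using p0 by (auto simp: distribution_on_def)
  have ne: "F \<noteq> {}" using sum0 by auto
  define Q where "Q = (\<Sum>z\<in>F. q z)"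
  define M where "M = Max (q ` F)"
  define m where "m = Min (q ` F)"
  have Q: "0 < Q" unfolding Q_def using fin ne pos by (intro sum_pos) auto
  have m: "0 < m" unfolding m_def using fin ne pos by simp
  have mq: "m \<le> q x" and qM: "q x \<le> M" if "x \<in> F" for x
    using that fin by (auto simp: m_def M_def)
  have M: "0 < M" using m mq qM ne by fastforce
  define g where "g t x = p t x / q x - 1 / Q" for t x
  define N where "N f = (\<Sum>x\<in>F. q x * (f x)\<^sup>2)" for f :: "'a \<Rightarrow> real"
  have next_g: "g (Suc t) y = (\<Sum>x\<in>F. c x y * g t x) / q y" if y: "y \<in> F" for t y
  proof -
    have "(\<Sum>x\<in>F. c x y * g t x) = (\<Sum>x\<in>F. p t x * (c x y / q x)) - (\<Sum>x\<in>F. c x y) / Q"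
      by (simp add: g_def algebra_simps sum_subtractf sum_divide_distrib)
    also have "(\<Sum>x\<in>F. c x y) = q y"
      using row[OF y] sym y by (simp cong: sum.cong)
    finally show ?thesis using pos[OF y] step[OF y] by (simp add: g_def field_simps)
  qed
  have main: "(\<Sum>x\<in>F. q x * g t x) = 0 \<and> N (g t) \<le> (\<mu> ^ t)\<^sup>2 * N (g 0)" for t
  proof (induction t)
    case 0
    have "(\<Sum>x\<in>F. q x * g 0 x) = (\<Sum>x\<in>F. p 0 x - q x / Q)"
      using pos by (intro sum.cong) (auto simp: g_def field_simps less_imp_neq[symmetric])
    also have "\<dots> = 0"
      using Q by (simp add: sum_subtractf sum0 sum_divide_distrib[symmetric] Q_def[symmetric])
    finally show ?case by simp
  next
    case (Suc t)
    note contr = symmetric_kernel_contraction[OF fin sym row pos \<mu> form, of "g t"]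
    have "(\<Sum>x\<in>F. q x * g (Suc t) x) = 0"
      using contr(1) Suc by (simp add: next_g cong: sum.cong)
    moreover have "N (g (Suc t)) \<le> \<mu>\<^sup>2 * N (g t)"
      using contr(2) Suc unfolding N_def by (simp add: next_g cong: sum.cong)
    moreover have "\<mu>\<^sup>2 * N (g t) \<le> \<mu>\<^sup>2 * ((\<mu> ^ t)\<^sup>2 * N (g 0))"
      using Suc by (intro mult_left_mono) auto
    ultimately show ?case by (simp add: power_mult_distrib mult_ac)
  qed
  have N0: "N (g 0) \<le> 1 / m"
  proof -
    have "N (g 0) = (\<Sum>x\<in>F. (p 0 x)\<^sup>2 / q x - 2 * p 0 x / Q + q x / Q\<^sup>2)"
      unfolding N_def
    proof (intro sum.cong refl)
      fix x assume "x \<in> F"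
      with pos have "q x \<noteq> 0" by force
      then show "q x * (g 0 x)\<^sup>2 = (p 0 x)\<^sup>2 / q x - 2 * p 0 x / Q + q x / Q\<^sup>2"
        using Q by (simp add: g_def field_simps power2_eq_square)
    qed
    also have "\<dots> = (\<Sum>x\<in>F. (p 0 x)\<^sup>2 / q x) - 2 * (\<Sum>x\<in>F. p 0 x) / Q + Q / Q\<^sup>2"
      by (simp add: sum.distrib sum_subtractf sum_divide_distrib[symmetric] sum_distrib_left[symmetric] Q_def)
    \<comment> \<open>The last two terms add up to -1 / Q, which is dropped.\<close>
    also have "\<dots> \<le> (\<Sum>x\<in>F. (p 0 x)\<^sup>2 / q x)"
      using Q by (simp add: sum0 power2_eq_square field_simps)
    also have "\<dots> \<le> (\<Sum>x\<in>F. p 0 x / m)"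
    proof (rule sum_mono)
      fix x assume x: "x \<in> F"
      have "p 0 x \<le> (\<Sum>x\<in>F. p 0 x)"
        using fin nonneg0 x by (intro member_le_sum) auto
      then have "(p 0 x)\<^sup>2 \<le> p 0 x"
        using sum0 nonneg0[OF x] by (simp add: power2_eq_square mult_left_le)
      then show "(p 0 x)\<^sup>2 / q x \<le> p 0 x / m"
        using m mq[OF x] nonneg0[OF x] by (intro frac_le) auto
    qed
    also have "\<dots> = 1 / m" by (simp add: sum_divide_distrib[symmetric] sum0)
    finally show ?thesis .
  qed
  have "(\<Sum>x\<in>F. (p t x - q x / Q)\<^sup>2) \<le> (\<Sum>x\<in>F. M * (q x * (g t x)\<^sup>2))"
  proof (rule sum_mono)
    fix x assume x: "x \<in> F"
    have "(p t x - q x / Q)\<^sup>2 = q x * (q x * (g t x)\<^sup>2)"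
      using pos[OF x] by (simp add: g_def field_simps power2_eq_square)
    also have "\<dots> \<le> M * (q x * (g t x)\<^sup>2)"
      using qM[OF x] pos[OF x] by (intro mult_right_mono) auto
    finally show "(p t x - q x / Q)\<^sup>2 \<le> M * (q x * (g t x)\<^sup>2)" .
  qed
  also have "\<dots> = M * N (g t)" by (simp add: N_def sum_distrib_left)
  also have "\<dots> \<le> M * ((\<mu> ^ t)\<^sup>2 * (1 / m))"
    using M main[of t] N0 by (intro mult_left_mono order.trans[OF conjunct2[OF main]]) auto
  also have "\<dots> = M / m * (\<mu> ^ t)\<^sup>2" by simp
  finally have "L2_set (\<lambda>x. p t x - q x / Q) F \<le> sqrt (M / m * (\<mu> ^ t)\<^sup>2)"
    unfolding L2_set_def by (rule real_sqrt_le_mono)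
  also have "\<dots> = sqrt (M / m) * \<mu> ^ t"
    using \<mu> by (simp only: real_sqrt_mult real_sqrt_abs) simp
  finally show ?thesis by (simp add: Q_def M_def m_def)
qed

section \<open>Cheeger's inequality\<close>

text \<open>The threshold is the least value of \<open>g\<close> whose sublevel set carries at least
  half of the mass; the sublevel set of the preceding value, if any, carries less.\<close>

lemma weighted_median_exists:
  fixes \<pi> g :: "'a \<Rightarrow> real"
  assumes fin: "finite U" and nonneg: "\<And>x. x \<in> U \<Longrightarrow> 0 \<le> \<pi> x"
  obtains t where "(\<Sum>x\<in>{x\<in>U. t < g x}. \<pi> x) \<le> (\<Sum>x\<in>U. \<pi> x) / 2"
    and "(\<Sum>x\<in>{x\<in>U. g x < t}. \<pi> x) \<le> (\<Sum>x\<in>U. \<pi> x) / 2"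
proof (cases "U = {}")
  case True
  then show ?thesis using that by simp
next
  case False
  define W where "W = (\<Sum>x\<in>U. \<pi> x)"
  have W: "0 \<le> W" unfolding W_def using nonneg by (intro sum_nonneg) auto
  define L where "L t = (\<Sum>x\<in>{x\<in>U. g x \<le> t}. \<pi> x)" for t
  define A where "A = {t \<in> g ` U. W / 2 \<le> L t}"
  have finA: "finite A" using fin by (simp add: A_def)
  have "{x\<in>U. g x \<le> Max (g ` U)} = U" using fin by auto
  then have "Max (g ` U) \<in> A"
    using fin False W by (simp add: A_def L_def W_def)
  then have neA: "A \<noteq> {}" by auto
  define t where "t = Min A"
  have tA: "t \<in> A" using finA neA by (simp add: t_def)
  have "L t + (\<Sum>x\<in>{x\<in>U. t < g x}. \<pi> x) = W"
    unfolding L_def W_def using fin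
    by (subst sum.union_disjoint[symmetric]) (auto intro!: sum.cong)
  then have up: "(\<Sum>x\<in>{x\<in>U. t < g x}. \<pi> x) \<le> W / 2"
    using tA by (simp add: A_def)
  have "(\<Sum>x\<in>{x\<in>U. g x < t}. \<pi> x) \<le> W / 2"
  proof (cases "{x\<in>U. g x < t} = {}")
    case True
    then show ?thesis using W by (simp only: sum.empty)
  next
    case nonempty: False
    define s where "s = Max (g ` {x\<in>U. g x < t})"
    have s: "s \<in> g ` {x\<in>U. g x < t}"
      unfolding s_def using fin nonempty by (intro Max_in) auto
    have "s \<notin> A"
      using s Min_le[OF finA] by (auto simp: t_def not_less[symmetric])
    with s have "L s < W / 2" by (auto simp: A_def)
    moreover have "g x \<le> s" if "x \<in> U" "g x < t" for x
      unfolding s_def using fin that by (intro Max_ge) auto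
    then have "{x\<in>U. g x < t} = {x\<in>U. g x \<le> s}"
      using s by auto
    ultimately show ?thesis by (simp add: L_def)
  qed
  with up show ?thesis using that by (simp add: W_def)
qed

text \<open>A weighted graph with vertex degrees \<open>\<pi>\<close> and conductance at least
  \<open>h\<close>. Degrees may be zero, so weightless non-faces can stay among the
  vertices.\<close>

locale conductance =
  fixes U :: "'a set" and a :: "'a \<Rightarrow> 'a \<Rightarrow> real" and \<pi> :: "'a \<Rightarrow> real" and h :: real
  assumes fin: "finite U"
    and sym: "\<And>x y. x \<in> U \<Longrightarrow> y \<in> U \<Longrightarrow> a x y = a y x"
    and nonneg: "\<And>x y. x \<in> U \<Longrightarrow> y \<in> U \<Longrightarrow> 0 \<le> a x y"
    and row: "\<And>x. x \<in> U \<Longrightarrow> (\<Sum>y\<in>U. a x y) = \<pi> x"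
    and h: "0 < h"
    and cut: "\<And>S. S \<subseteq> U \<Longrightarrow> (\<Sum>x\<in>S. \<pi> x) \<le> (\<Sum>x\<in>U. \<pi> x) / 2 \<Longrightarrow>
      h * (\<Sum>x\<in>S. \<pi> x) \<le> (\<Sum>x\<in>S. \<Sum>y\<in>U - S. a x y)"
begin

lemma measure_nonneg: "x \<in> U \<Longrightarrow> 0 \<le> \<pi> x"
  using row nonneg by (metis sum_nonneg)

lemma sum_fst: "(\<Sum>x\<in>U. \<Sum>y\<in>U. a x y * f x) = (\<Sum>x\<in>U. \<pi> x * f x)"
  by (intro sum.cong refl) (simp add: row sum_distrib_right[symmetric])

lemma sum_snd: "(\<Sum>x\<in>U. \<Sum>y\<in>U. a x y * f y) = (\<Sum>x\<in>U. \<pi> x * f x)"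
proof -
  have "(\<Sum>x\<in>U. \<Sum>y\<in>U. a x y * f y) = (\<Sum>y\<in>U. \<Sum>x\<in>U. a x y * f y)" by (rule sum.swap)
  also have "\<dots> = (\<Sum>y\<in>U. \<Sum>x\<in>U. a y x * f y)" by (intro sum.cong refl) (simp add: sym)
  finally show ?thesis by (simp add: sum_fst)
qed

text \<open>Induction on the support, peeling off the least positive value, replaces the co-area formula.\<close>

lemma total_variation_ge:
  assumes "\<And>x. x \<in> U \<Longrightarrow> 0 \<le> r x"
    and "(\<Sum>x\<in>{x\<in>U. 0 < r x}. \<pi> x) \<le> (\<Sum>x\<in>U. \<pi> x) / 2"
  shows "2 * h * (\<Sum>x\<in>U. \<pi> x * r x) \<le> (\<Sum>x\<in>U. \<Sum>y\<in>U. a x y * \<bar>r x - r y\<bar>)"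
  using assms
proof (induction "card {x\<in>U. 0 < r x}" arbitrary: r rule: less_induct)
  case less
  define S where "S = {x\<in>U. 0 < r x}"
  have SU: "S \<subseteq> U" and finS: "finite S" using fin by (auto simp: S_def)
  show ?case
  proof (cases "S = {}")
    case True
    then have "r x = 0" if "x \<in> U" for x
      using less.prems(1)[OF that] that by (auto simp: S_def not_less intro: antisym)
    then show ?thesis using fin by simp
  next
    case False
    define m where "m = Min (r ` S)"
    have m: "m \<in> r ` S" unfolding m_def using finS False by simp
    then have mpos: "0 < m" by (auto simp: S_def)
    have mle: "m \<le> r x" if "x \<in> S" for x using finS that by (simp add: m_def)
    define i where "i x = (if x \<in> S then 1 else 0 :: real)" for x
    define r' where "r' x = r x - m * i x" for x
    have r0: "r x = 0" if "x \<in> U" "x \<notin> S" for x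
      using less.prems(1)[OF that(1)] that by (auto simp: S_def)
    have r'nn: "0 \<le> r' x" if "x \<in> U" for x
      using mle[of x] less.prems(1)[OF that] by (simp add: r'_def i_def)
    have sub: "{x\<in>U. 0 < r' x} \<subset> S"
    proof -
      obtain z where z: "z \<in> S" "r z = m" using m by auto
      then have "z \<notin> {x\<in>U. 0 < r' x}" by (simp add: r'_def i_def)
      moreover have "{x\<in>U. 0 < r' x} \<subseteq> S"
        using mpos by (auto simp: r'_def i_def S_def split: if_splits)
      ultimately show ?thesis using z by blast
    qed
    have "(\<Sum>x\<in>{x\<in>U. 0 < r' x}. \<pi> x) \<le> (\<Sum>x\<in>S. \<pi> x)"
      using sub finS SU measure_nonneg by (intro sum_mono2) auto
    also have "\<dots> \<le> (\<Sum>x\<in>U. \<pi> x) / 2" using less.prems(2) by (simp add: S_def)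
    finally have IH: "2 * h * (\<Sum>x\<in>U. \<pi> x * r' x) \<le> (\<Sum>x\<in>U. \<Sum>y\<in>U. a x y * \<bar>r' x - r' y\<bar>)"
      using less.hyps[of r'] psubset_card_mono[OF finS sub] r'nn by (simp add: S_def)
    have cutS: "h * (\<Sum>x\<in>S. \<pi> x) \<le> (\<Sum>x\<in>S. \<Sum>y\<in>U - S. a x y)"
      using cut[OF SU] less.prems(2) by (simp add: S_def)
    \<comment> \<open>As \<open>r'\<close> is nonnegative and vanishes off \<open>S\<close>, the
      indicator part never opposes the sign of \<open>r' x - r' y\<close>, so absolute values add
      exactly. The two products are the two orientations of a cut pair, whence the factor 2 in the
      claim.\<close>
    have split: "\<bar>r x - r y\<bar> = \<bar>r' x - r' y\<bar> + m * (i x * (1 - i y)) + m * ((1 - i x) * i y)"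
      if "x \<in> U" "y \<in> U" for x y
      using that mle[of x] mle[of y] r0[of x] r0[of y] mpos by (auto simp: r'_def i_def)
    have cross: "(\<Sum>x\<in>U. \<Sum>y\<in>U. a x y * (i x * (1 - i y))) = (\<Sum>x\<in>S. \<Sum>y\<in>U - S. a x y)"
    proof -
      have "(\<Sum>x\<in>U. \<Sum>y\<in>U. a x y * (i x * (1 - i y))) = (\<Sum>x\<in>S. \<Sum>y\<in>U. a x y * (i x * (1 - i y)))"
        using fin SU by (intro sum.mono_neutral_right) (auto simp: i_def)
      also have "\<dots> = (\<Sum>x\<in>S. \<Sum>y\<in>U - S. a x y * (i x * (1 - i y)))"
        using fin by (intro sum.cong refl sum.mono_neutral_right) (auto simp: i_def)
      also have "\<dots> = (\<Sum>x\<in>S. \<Sum>y\<in>U - S. a x y)"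
        by (intro sum.cong refl) (auto simp: i_def)
      finally show ?thesis .
    qed
    have cross': "(\<Sum>x\<in>U. \<Sum>y\<in>U. a x y * ((1 - i x) * i y)) = (\<Sum>x\<in>S. \<Sum>y\<in>U - S. a x y)"
    proof -
      have "(\<Sum>x\<in>U. \<Sum>y\<in>U. a x y * ((1 - i x) * i y)) = (\<Sum>y\<in>U. \<Sum>x\<in>U. a x y * ((1 - i x) * i y))"
        by (rule sum.swap)
      also have "\<dots> = (\<Sum>x\<in>U. \<Sum>y\<in>U. a x y * (i x * (1 - i y)))"
        by (intro sum.cong refl) (simp add: sym mult.commute)
      finally show ?thesis by (simp add: cross)
    qed
    have "(\<Sum>x\<in>U. \<Sum>y\<in>U. a x y * \<bar>r x - r y\<bar>) =
        (\<Sum>x\<in>U. \<Sum>y\<in>U. a x y * \<bar>r' x - r' y\<bar> + m * (a x y * (i x * (1 - i y)))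
          + m * (a x y * ((1 - i x) * i y)))"
      by (intro sum.cong refl) (simp add: split algebra_simps)
    also have "\<dots> = (\<Sum>x\<in>U. \<Sum>y\<in>U. a x y * \<bar>r' x - r' y\<bar>) + 2 * m * (\<Sum>x\<in>S. \<Sum>y\<in>U - S. a x y)"
      by (simp add: sum.distrib sum_distrib_left[symmetric] cross cross')
    finally have lhs: "(\<Sum>x\<in>U. \<Sum>y\<in>U. a x y * \<bar>r x - r y\<bar>) = \<dots>" .
    have "(\<Sum>x\<in>U. \<pi> x * i x) = (\<Sum>x\<in>S. \<pi> x * i x)"
      using fin SU by (intro sum.mono_neutral_right) (auto simp: i_def)
    then have iS: "(\<Sum>x\<in>U. \<pi> x * i x) = (\<Sum>x\<in>S. \<pi> x)" by (simp add: i_def)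
    have "(\<Sum>x\<in>U. \<pi> x * r x) = (\<Sum>x\<in>U. \<pi> x * r' x) + m * (\<Sum>x\<in>S. \<pi> x)"
      by (simp add: r'_def iS[symmetric] sum_distrib_left sum.distrib[symmetric] algebra_simps)
    then have "2 * h * (\<Sum>x\<in>U. \<pi> x * r x) =
        2 * h * (\<Sum>x\<in>U. \<pi> x * r' x) + 2 * m * (h * (\<Sum>x\<in>S. \<pi> x))"
      by (simp add: algebra_simps)
    also have "\<dots> \<le> (\<Sum>x\<in>U. \<Sum>y\<in>U. a x y * \<bar>r' x - r' y\<bar>) + 2 * m * (\<Sum>x\<in>S. \<Sum>y\<in>U - S. a x y)"
      using IH cutS mpos by (intro add_mono mult_left_mono) auto
    finally show ?thesis by (simp only: lhs)
  qed
qed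

text \<open>The total variation bound is applied to the square of \<open>p\<close>, and the
  difference of squares is factored. A weighted AM-GM takes the place of Cauchy-Schwarz; its weight
  is chosen so that the second half sums to h P and is absorbed by the 2 h P on the left.\<close>

lemma energy_ge_half_supported:
  assumes nn: "\<And>x. x \<in> U \<Longrightarrow> 0 \<le> p x"
    and half: "(\<Sum>x\<in>{x\<in>U. 0 < p x}. \<pi> x) \<le> (\<Sum>x\<in>U. \<pi> x) / 2"
  shows "h\<^sup>2 * (\<Sum>x\<in>U. \<pi> x * (p x)\<^sup>2) \<le> (\<Sum>x\<in>U. \<Sum>y\<in>U. a x y * (p x - p y)\<^sup>2)"
proof -
  define P where "P = (\<Sum>x\<in>U. \<pi> x * (p x)\<^sup>2)"
  define D where "D = (\<Sum>x\<in>U. \<Sum>y\<in>U. a x y * (p x - p y)\<^sup>2)"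
  have "{x\<in>U. 0 < (p x)\<^sup>2} = {x\<in>U. 0 < p x}"
    using nn by (auto simp: less_le)
  then have "2 * h * P \<le> (\<Sum>x\<in>U. \<Sum>y\<in>U. a x y * \<bar>(p x)\<^sup>2 - (p y)\<^sup>2\<bar>)"
    unfolding P_def using half by (intro total_variation_ge) auto
  also have "\<dots> \<le> (\<Sum>x\<in>U. \<Sum>y\<in>U. a x y * ((p x - p y)\<^sup>2 / h + h / 2 * ((p x)\<^sup>2 + (p y)\<^sup>2)))"
  proof (intro sum_mono mult_left_mono nonneg)
    fix x y assume xy: "x \<in> U" "y \<in> U"
    define u v where "u = \<bar>p x - p y\<bar>" and "v = \<bar>p x + p y\<bar>"
    have "\<bar>(p x)\<^sup>2 - (p y)\<^sup>2\<bar> = u * v"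
      by (simp add: u_def v_def abs_mult[symmetric] power2_eq_square algebra_simps)
    also have "u * v \<le> u\<^sup>2 / h + h / 4 * v\<^sup>2"
    proof -
      have "0 \<le> (u - h / 2 * v)\<^sup>2 / h" using h by simp
      also have "\<dots> = u\<^sup>2 / h + h / 4 * v\<^sup>2 - u * v"
        using h by (simp add: field_simps power2_eq_square)
      finally show ?thesis by simp
    qed
    also have "v\<^sup>2 \<le> 2 * ((p x)\<^sup>2 + (p y)\<^sup>2)"
      using zero_le_power2[of "p x - p y"] by (simp add: v_def power2_eq_square algebra_simps)
    then have "u\<^sup>2 / h + h / 4 * v\<^sup>2 \<le> u\<^sup>2 / h + h / 4 * (2 * ((p x)\<^sup>2 + (p y)\<^sup>2))"
      using h by (intro add_left_mono mult_left_mono) auto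
    finally show "\<bar>(p x)\<^sup>2 - (p y)\<^sup>2\<bar> \<le> (p x - p y)\<^sup>2 / h + h / 2 * ((p x)\<^sup>2 + (p y)\<^sup>2)"
      by (simp add: u_def algebra_simps)
  qed
  also have "\<dots> = D / h + h / 2 * ((\<Sum>x\<in>U. \<Sum>y\<in>U. a x y * (p x)\<^sup>2) + (\<Sum>x\<in>U. \<Sum>y\<in>U. a x y * (p y)\<^sup>2))"
    by (simp add: D_def sum_divide_distrib sum_distrib_left sum.distrib[symmetric] algebra_simps)
  also have "\<dots> = D / h + h * P"
    by (simp add: sum_fst[of "\<lambda>x. (p x)\<^sup>2"] sum_snd[of "\<lambda>x. (p x)\<^sup>2"] P_def)
  finally have "h * P \<le> D / h" by (simp add: mult.commute)
  then show ?thesis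
    using h by (simp add: P_def D_def field_simps power2_eq_square)
qed

text \<open>The positive and negative parts about a weighted median each live on at most half of the
  mass. The mean \<open>c\<close> minimises the second moment, so it may be exchanged for the
  median, and the cross terms between the two parts only increase the energy. Expressing that
  \<open>c\<close> is the mean by a vanishing sum avoids dividing by a total mass that may be
  zero.\<close>

lemma cheeger:
  assumes mean: "(\<Sum>x\<in>U. \<pi> x * (g x - c)) = 0"
  shows "h\<^sup>2 * (\<Sum>x\<in>U. \<pi> x * (g x - c)\<^sup>2) \<le> (\<Sum>x\<in>U. \<Sum>y\<in>U. a x y * (g x - g y)\<^sup>2)"
proof -
  obtain t where up: "(\<Sum>x\<in>{x\<in>U. t < g x}. \<pi> x) \<le> (\<Sum>x\<in>U. \<pi> x) / 2"
    and lo: "(\<Sum>x\<in>{x\<in>U. g x < t}. \<pi> x) \<le> (\<Sum>x\<in>U. \<pi> x) / 2"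
    using weighted_median_exists[OF fin, of \<pi> g] measure_nonneg by blast
  define p q where "p x = max 0 (g x - t)" and "q x = max 0 (t - g x)" for x
  have supp: "{x\<in>U. 0 < p x} = {x\<in>U. t < g x}" "{x\<in>U. 0 < q x} = {x\<in>U. g x < t}"
    by (auto simp: p_def q_def)
  have ep: "h\<^sup>2 * (\<Sum>x\<in>U. \<pi> x * (p x)\<^sup>2) \<le> (\<Sum>x\<in>U. \<Sum>y\<in>U. a x y * (p x - p y)\<^sup>2)"
    using up supp by (intro energy_ge_half_supported) (auto simp: p_def)
  have eq: "h\<^sup>2 * (\<Sum>x\<in>U. \<pi> x * (q x)\<^sup>2) \<le> (\<Sum>x\<in>U. \<Sum>y\<in>U. a x y * (q x - q y)\<^sup>2)"
    using lo supp by (intro energy_ge_half_supported) (auto simp: q_def)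
  have pq: "(g x - t)\<^sup>2 = (p x)\<^sup>2 + (q x)\<^sup>2" for x
    by (simp add: p_def q_def max_def power2_commute)
  have "(\<Sum>x\<in>U. \<pi> x * (g x - c)\<^sup>2) \<le> (\<Sum>x\<in>U. \<pi> x * (g x - t)\<^sup>2)"
  proof -
    have "(\<Sum>x\<in>U. \<pi> x * (g x - t)\<^sup>2)
        = (\<Sum>x\<in>U. \<pi> x * (g x - c)\<^sup>2 + 2 * (c - t) * (\<pi> x * (g x - c)) + (c - t)\<^sup>2 * \<pi> x)"
      by (intro sum.cong refl) (simp add: power2_eq_square algebra_simps)
    also have "\<dots> = (\<Sum>x\<in>U. \<pi> x * (g x - c)\<^sup>2) + (c - t)\<^sup>2 * (\<Sum>x\<in>U. \<pi> x)"
      by (simp add: sum.distrib sum_distrib_left[symmetric] mean)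
    finally show ?thesis
      using sum_nonneg[of U \<pi>] measure_nonneg by simp
  qed
  then have "h\<^sup>2 * (\<Sum>x\<in>U. \<pi> x * (g x - c)\<^sup>2) \<le> h\<^sup>2 * (\<Sum>x\<in>U. \<pi> x * (g x - t)\<^sup>2)"
    by (intro mult_left_mono) auto
  also have "\<dots> = h\<^sup>2 * (\<Sum>x\<in>U. \<pi> x * (p x)\<^sup>2) + h\<^sup>2 * (\<Sum>x\<in>U. \<pi> x * (q x)\<^sup>2)"
    by (simp add: pq algebra_simps sum.distrib)
  also have "\<dots> \<le> (\<Sum>x\<in>U. \<Sum>y\<in>U. a x y * (p x - p y)\<^sup>2) + (\<Sum>x\<in>U. \<Sum>y\<in>U. a x y * (q x - q y)\<^sup>2)"
    using ep eq by (rule add_mono)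
  also have "\<dots> = (\<Sum>x\<in>U. \<Sum>y\<in>U. a x y * ((p x - p y)\<^sup>2 + (q x - q y)\<^sup>2))"
    by (simp add: algebra_simps sum.distrib)
  also have "\<dots> \<le> (\<Sum>x\<in>U. \<Sum>y\<in>U. a x y * (g x - g y)\<^sup>2)"
  proof (intro sum_mono mult_left_mono nonneg)
    fix x y
    have gpq: "g z = t + p z - q z" for z by (simp add: p_def q_def max_def)
    have "0 \<le> p x * q y" "0 \<le> p y * q x" "p x * q x = 0" "p y * q y = 0"
      by (simp_all add: p_def q_def max_def)
    moreover have "(g x - g y)\<^sup>2 = (p x - p y)\<^sup>2 + (q x - q y)\<^sup>2
        + 2 * (p x * q y) + 2 * (p y * q x) - 2 * (p x * q x) - 2 * (p y * q y)"
      unfolding gpq by (simp add: power2_eq_square algebra_simps)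
    ultimately have "(g x - g y)\<^sup>2 \<ge> (p x - p y)\<^sup>2 + (q x - q y)\<^sup>2" by linarith
    then show "(p x - p y)\<^sup>2 + (q x - q y)\<^sup>2 \<le> (g x - g y)\<^sup>2" .
  qed
  finally show ?thesis .
qed

end

section \<open>From links to the whole complex\<close>

lemma card_sets_between_Suc:
  assumes "finite t" "s \<subseteq> t"
  shows "card {r. s \<subseteq> r \<and> r \<subseteq> t \<and> card r = Suc (card s)} = card t - card s"
proof -
  have fs: "finite s" using assms finite_subset by blast
  have "{r. s \<subseteq> r \<and> r \<subseteq> t \<and> card r = Suc (card s)} = (\<lambda>v. insert v s) ` (t - s)"
  proof (intro equalityI subsetI)
    fix r assume "r \<in> {r. s \<subseteq> r \<and> r \<subseteq> t \<and> card r = Suc (card s)}"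
    then have r: "s \<subseteq> r" "r \<subseteq> t" "card r = Suc (card s)" by auto
    have "card (r - s) = 1" using r fs by (simp add: card_Diff_subset)
    then obtain v where "r - s = {v}" by (auto simp: card_1_singleton_iff)
    then show "r \<in> (\<lambda>v. insert v s) ` (t - s)" using r by blast
  qed (use assms fs in auto)
  moreover have "inj_on (\<lambda>v. insert v s) (t - s)" by (rule inj_onI) blast
  ultimately show ?thesis using assms fs by (simp add: card_image card_Diff_subset)
qed

text \<open>Lagrange's identity; it turns squares of sums over facets into Dirichlet forms.\<close>

lemma sum_power2_eq:
  fixes f :: "'a \<Rightarrow> real"
  shows "(\<Sum>x\<in>A. f x)\<^sup>2 = real (card A) * (\<Sum>x\<in>A. (f x)\<^sup>2) - (\<Sum>x\<in>A. \<Sum>y\<in>A. (f x - f y)\<^sup>2) / 2"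
proof -
  have "(\<Sum>x\<in>A. \<Sum>y\<in>A. (f x - f y)\<^sup>2) = (\<Sum>x\<in>A. \<Sum>y\<in>A. (f x)\<^sup>2 + (f y)\<^sup>2 - 2 * (f x * f y))"
    by (intro sum.cong refl) (simp add: power2_eq_square algebra_simps)
  also have "\<dots> = 2 * (real (card A) * (\<Sum>x\<in>A. (f x)\<^sup>2)) - 2 * (\<Sum>x\<in>A. f x)\<^sup>2"
    by (simp add: sum.distrib sum_subtractf power2_eq_square sum_product sum_distrib_left[symmetric])
  finally show ?thesis by (simp add: diff_divide_distrib)
qed

locale uniform_hypergraph =
  fixes V :: "'v set" and T :: "'v set set" and d :: nat
  assumes finV: "finite V" and TV: "T \<subseteq> Pow V" and cardT: "\<And>t. t \<in> T \<Longrightarrow> card t = Suc d"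
begin

text \<open>Functions live on all \<open>k\<close>-element subsets of \<open>V\<close>, not only on faces: non-faces have weight \<open>0\<close>,
  so that no sum has to be restricted to the complex.\<close>

definition K :: "nat \<Rightarrow> 'v set set" where "K k = {s. s \<subseteq> V \<and> card s = k}"

definition w :: "'v set \<Rightarrow> real" where "w s = real (card {t \<in> T. s \<subseteq> t})"

text \<open>The weight of a step of the walk. The size condition excludes \<open>s' = s\<close>, so
  the diagonal vanishes; symmetry needs sets of equal size.\<close>

definition b :: "'v set \<Rightarrow> 'v set \<Rightarrow> real" where
  "b s s' = (if card (s \<union> s') = Suc (card s) then w (s \<union> s') else 0)"

text \<open>Summing over ordered pairs gives twice the usual Dirichlet form; the factors 2 in the
  gap inequalities compensate for this.\<close>

definition energy :: "nat \<Rightarrow> ('v set \<Rightarrow> real) \<Rightarrow> real" where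
  "energy k f = (\<Sum>s\<in>K k. \<Sum>s'\<in>K k. b s s' * (f s - f s')\<^sup>2)"

definition sqnorm :: "nat \<Rightarrow> ('v set \<Rightarrow> real) \<Rightarrow> real" where
  "sqnorm k f = (\<Sum>s\<in>K k. w s * (f s)\<^sup>2)"

lemma finK [simp]: "finite (K k)"
  using finV by (simp add: K_def)

lemma finT [simp]: "finite T"
  using finV TV finite_subset by blast

lemma K_finite: "s \<in> K k \<Longrightarrow> finite s"
  using finV by (auto simp: K_def intro: finite_subset)

lemma w_nonneg [simp]: "0 \<le> w s"
  by (simp add: w_def)

lemma b_nonneg [simp]: "0 \<le> b s s'"
  by (simp add: b_def)

lemma b_sym: "s \<in> K k \<Longrightarrow> s' \<in> K k \<Longrightarrow> b s s' = b s' s"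
  by (simp add: b_def K_def Un_commute)

lemma b_self [simp]: "b s s = 0"
  by (simp add: b_def)

lemma w_antimono: "s \<subseteq> s' \<Longrightarrow> w s' \<le> w s"
  by (auto simp: w_def intro!: card_mono)

lemma sqnorm_nonneg: "0 \<le> sqnorm k f"
  by (simp add: sqnorm_def sum_nonneg)

text \<open>Double counting: a member of \<open>T\<close> above \<open>s\<close> contains d + 1 - k
  sets with one element more than \<open>s\<close>. The factor may be negative, but then
  \<open>w s\<close> is 0.\<close>

lemma sum_w_up:
  assumes s: "s \<in> K k"
  shows "(\<Sum>t | t \<in> K (Suc k) \<and> s \<subseteq> t. w t) = (real d + 1 - real k) * w s"
proof -
  have "(\<Sum>t | t \<in> K (Suc k) \<and> s \<subseteq> t. w t)
      = (\<Sum>t | t \<in> K (Suc k) \<and> s \<subseteq> t. \<Sum>u\<in>T. of_bool (t \<subseteq> u))"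
    by (simp add: w_def sum.If_cases of_bool_def Int_def)
  also have "\<dots> = (\<Sum>u\<in>T. \<Sum>t | t \<in> K (Suc k) \<and> s \<subseteq> t. of_bool (t \<subseteq> u))"
    by (rule sum.swap)
  also have "\<dots> = (\<Sum>u\<in>T. of_bool (s \<subseteq> u) * (real d + 1 - real k))"
  proof (intro sum.cong refl)
    fix u assume u: "u \<in> T"
    have finu: "finite u" using u TV finV finite_subset by blast
    have "(\<Sum>t | t \<in> K (Suc k) \<and> s \<subseteq> t. of_bool (t \<subseteq> u)) =
        real (card ({t \<in> K (Suc k). s \<subseteq> t} \<inter> {t. t \<subseteq> u}))"
      by (simp add: of_bool_def sum.If_cases)
    also have "\<dots> = of_bool (s \<subseteq> u) * (real d + 1 - real k)"
    proof (cases "s \<subseteq> u")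
      case True
      have "{t \<in> K (Suc k). s \<subseteq> t} \<inter> {t. t \<subseteq> u} = {r. s \<subseteq> r \<and> r \<subseteq> u \<and> card r = Suc (card s)}"
        using u TV s by (fastforce simp: K_def)
      moreover have "card s \<le> card u" using True finu by (rule card_mono[rotated])
      ultimately show ?thesis
        using card_sets_between_Suc[OF finu True] cardT[OF u] s True by (simp add: K_def)
    next
      case False
      then have "{t \<in> K (Suc k). s \<subseteq> t} \<inter> {t. t \<subseteq> u} = {}" by auto
      then show ?thesis using False by simp
    qed
    finally show "(\<Sum>t | t \<in> K (Suc k) \<and> s \<subseteq> t. of_bool (t \<subseteq> u)) = of_bool (s \<subseteq> u) * (real d + 1 - real k)" .
  qed
  also have "\<dots> = w s * (real d + 1 - real k)"
    by (simp add: w_def sum_distrib_right[symmetric] of_bool_def sum.If_cases Int_def)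
  finally show ?thesis by simp
qed

lemma card_facets:
  assumes "t \<in> K (Suc k)"
  shows "card {s \<in> K k. s \<subseteq> t} = Suc k"
proof -
  have "{s \<in> K k. s \<subseteq> t} = {s. s \<subseteq> t \<and> card s = k}"
    using assms by (auto simp: K_def)
  then show ?thesis
    using assms n_subsets[OF K_finite[OF assms], of k] by (simp add: K_def)
qed

lemma sum_swap_incident:
  "(\<Sum>t\<in>K m. \<Sum>s | s \<in> K k \<and> s \<subseteq> t. F s t) = (\<Sum>s\<in>K k. \<Sum>t | t \<in> K m \<and> s \<subseteq> t. (F s t :: real))"
  using sum.swap_restrict[of "K m" "K k" "\<lambda>t s. F s t" "\<lambda>t s. s \<subseteq> t"] by simp

text \<open>Two distinct sets of size \<open>k\<close> have at most one common superset of size k +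
  1, their union.\<close>

lemma b_eq_sum:
  assumes s: "s \<in> K k" and s': "s' \<in> K k" and ne: "s \<noteq> s'"
  shows "b s s' = (\<Sum>t | t \<in> K (Suc k) \<and> s \<subseteq> t \<and> s' \<subseteq> t. w t)"
proof -
  have fin: "finite s" "finite s'" using s s' K_finite by auto
  have gt: "card (s \<union> s') > k"
  proof -
    have "\<not> s' \<subseteq> s" using s s' ne fin card_subset_eq[of s s'] by (auto simp: K_def)
    then have "s \<subset> s \<union> s'" by auto
    then show ?thesis using psubset_card_mono[of "s \<union> s'" s] fin s by (simp add: K_def)
  qed
  have eq: "{t. t \<in> K (Suc k) \<and> s \<subseteq> t \<and> s' \<subseteq> t} = (if card (s \<union> s') = Suc k then {s \<union> s'} else {})"
  proof -
    have "t = s \<union> s' \<and> card (s \<union> s') = Suc k" if t: "t \<in> K (Suc k)" "s \<subseteq> t" "s' \<subseteq> t" for t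
    proof -
      have sub: "s \<union> s' \<subseteq> t" and ft: "finite t" and ct: "card t = Suc k"
        using t K_finite[OF t(1)] by (auto simp: K_def)
      have "card (s \<union> s') = Suc k" using card_mono[OF ft sub] gt ct by simp
      moreover from this have "s \<union> s' = t" using card_subset_eq[OF ft sub] ct by simp
      ultimately show ?thesis by simp
    qed
    then show ?thesis using s s' by (auto simp: K_def)
  qed
  show ?thesis using s unfolding eq by (simp add: b_def K_def)
qed

text \<open>Up to scale, the left side is the quadratic form of the up-down walk on sets of size
  \<open>k\<close>. Lagrange's identity inside each \<open>t\<close> expresses it by the energy of
  the non-lazy walk, so a gap of one walk is a gap of the other.\<close>

lemma facet_sums_sqnorm:
  "(\<Sum>t\<in>K (Suc k). w t * (\<Sum>s | s \<in> K k \<and> s \<subseteq> t. f s)\<^sup>2)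
    = (real k + 1) * (real d + 1 - real k) * sqnorm k f - energy k f / 2"
proof -
  have "(\<Sum>t\<in>K (Suc k). w t * (\<Sum>s | s \<in> K k \<and> s \<subseteq> t. f s)\<^sup>2) =
     (\<Sum>t\<in>K (Suc k). (real k + 1) * (\<Sum>s | s \<in> K k \<and> s \<subseteq> t. w t * (f s)\<^sup>2)
       - (\<Sum>s | s \<in> K k \<and> s \<subseteq> t. \<Sum>s' | s' \<in> K k \<and> s' \<subseteq> t. w t * (f s - f s')\<^sup>2) / 2)"
    by (intro sum.cong refl) (simp add: sum_power2_eq card_facets algebra_simps sum_distrib_left)
  also have "\<dots> = (real k + 1) * (\<Sum>t\<in>K (Suc k). \<Sum>s | s \<in> K k \<and> s \<subseteq> t. w t * (f s)\<^sup>2)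
     - (\<Sum>t\<in>K (Suc k). \<Sum>s | s \<in> K k \<and> s \<subseteq> t. \<Sum>s' | s' \<in> K k \<and> s' \<subseteq> t. w t * (f s - f s')\<^sup>2) / 2"
    by (simp add: sum_subtractf sum_distrib_left sum_divide_distrib)
  also have "(\<Sum>t\<in>K (Suc k). \<Sum>s | s \<in> K k \<and> s \<subseteq> t. w t * (f s)\<^sup>2) = (real d + 1 - real k) * sqnorm k f"
  proof -
    have "(\<Sum>t\<in>K (Suc k). \<Sum>s | s \<in> K k \<and> s \<subseteq> t. w t * (f s)\<^sup>2)
        = (\<Sum>s\<in>K k. (\<Sum>t | t \<in> K (Suc k) \<and> s \<subseteq> t. w t) * (f s)\<^sup>2)"
      by (simp add: sum_swap_incident sum_distrib_right)
    also have "\<dots> = (real d + 1 - real k) * sqnorm k f"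
      unfolding sqnorm_def sum_distrib_left by (intro sum.cong refl) (simp add: sum_w_up)
    finally show ?thesis .
  qed
  also have "(\<Sum>t\<in>K (Suc k). \<Sum>s | s \<in> K k \<and> s \<subseteq> t. \<Sum>s' | s' \<in> K k \<and> s' \<subseteq> t. w t * (f s - f s')\<^sup>2)
      = energy k f"
  proof -
    have "(\<Sum>t\<in>K (Suc k). \<Sum>s | s \<in> K k \<and> s \<subseteq> t. \<Sum>s' | s' \<in> K k \<and> s' \<subseteq> t. w t * (f s - f s')\<^sup>2)
        = (\<Sum>s\<in>K k. \<Sum>t | t \<in> K (Suc k) \<and> s \<subseteq> t. \<Sum>s' | s' \<in> K k \<and> s' \<subseteq> t. w t * (f s - f s')\<^sup>2)"
      by (rule sum_swap_incident)
    also have "\<dots> = energy k f"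
      unfolding energy_def
    proof (rule sum.cong[OF refl])
      fix s assume s: "s \<in> K k"
      have "(\<Sum>t | t \<in> K (Suc k) \<and> s \<subseteq> t. \<Sum>s' | s' \<in> K k \<and> s' \<subseteq> t. w t * (f s - f s')\<^sup>2)
          = (\<Sum>s'\<in>K k. \<Sum>t | t \<in> {t \<in> K (Suc k). s \<subseteq> t} \<and> s' \<subseteq> t. w t * (f s - f s')\<^sup>2)"
        using sum.swap_restrict[of "{t \<in> K (Suc k). s \<subseteq> t}" "K k" "\<lambda>t s'. w t * (f s - f s')\<^sup>2" "\<lambda>t s'. s' \<subseteq> t"]
        by simp
      also have "\<dots> = (\<Sum>s'\<in>K k. b s s' * (f s - f s')\<^sup>2)"
      proof (intro sum.cong refl)
        fix s' assume s': "s' \<in> K k"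
        show "(\<Sum>t | t \<in> {t \<in> K (Suc k). s \<subseteq> t} \<and> s' \<subseteq> t. w t * (f s - f s')\<^sup>2) = b s s' * (f s - f s')\<^sup>2"
          using b_eq_sum[OF s s'] by (cases "s = s'") (simp_all add: sum_distrib_right conj_assoc)
      qed
      finally show "(\<Sum>t | t \<in> K (Suc k) \<and> s \<subseteq> t. \<Sum>s' | s' \<in> K k \<and> s' \<subseteq> t. w t * (f s - f s')\<^sup>2)
        = (\<Sum>s'\<in>K k. b s s' * (f s - f s')\<^sup>2)" .
    qed
    finally show ?thesis .
  qed
  finally show ?thesis by simp
qed

section \<open>Distributing the energy over the links\<close>

lemma card_common_facets:
  assumes s: "s \<in> K (Suc k)" and s': "s' \<in> K (Suc k)" and "card (s \<union> s') = Suc (Suc k)"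
  shows "card {r \<in> K k. r \<subseteq> s \<and> r \<subseteq> s'} = 1"
proof -
  have "card (s \<inter> s') = k"
    using card_Un_Int[OF K_finite[OF s] K_finite[OF s']] assms by (simp add: K_def)
  moreover have "{r \<in> K k. r \<subseteq> s \<and> r \<subseteq> s'} = {r. r \<subseteq> s \<inter> s' \<and> card r = k}"
    using s by (auto simp: K_def)
  moreover have "finite (s \<inter> s')" using K_finite[OF s] by simp
  ultimately show ?thesis using n_subsets[of "s \<inter> s'" k] by simp
qed

text \<open>A pair of nonzero weight has exactly one common subset of size \<open>k\<close>, its
  intersection, and so is counted in the link of exactly one \<open>r\<close>. For
  \<open>s' = s\<close> there are k + 1 such subsets, but the weight is 0.\<close>

lemma sum_b_localise:
  assumes s: "s \<in> K (Suc k)"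
  shows "(\<Sum>s'\<in>K (Suc k). b s s' * F s')
    = (\<Sum>r | r \<in> K k \<and> r \<subseteq> s. \<Sum>s' | s' \<in> K (Suc k) \<and> r \<subseteq> s'. b s s' * F s')"
proof -
  have "(\<Sum>r | r \<in> K k \<and> r \<subseteq> s. \<Sum>s' | s' \<in> K (Suc k) \<and> r \<subseteq> s'. b s s' * F s')
     = (\<Sum>s'\<in>K (Suc k). \<Sum>r | r \<in> {r \<in> K k. r \<subseteq> s} \<and> r \<subseteq> s'. b s s' * F s')"
    using sum.swap_restrict[of "{r \<in> K k. r \<subseteq> s}" "K (Suc k)" "\<lambda>r s'. b s s' * F s'" "\<lambda>r s'. r \<subseteq> s'"]
    by simp
  also have "\<dots> = (\<Sum>s'\<in>K (Suc k). b s s' * F s')"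
  proof (intro sum.cong refl)
    fix s' assume s': "s' \<in> K (Suc k)"
    show "(\<Sum>r | r \<in> {r \<in> K k. r \<subseteq> s} \<and> r \<subseteq> s'. b s s' * F s') = b s s' * F s'"
    proof (cases "card (s \<union> s') = Suc (Suc k)")
      case True
      then show ?thesis using card_common_facets[OF s s' True] by (simp add: conj_assoc)
    next
      case False
      then have "b s s' = 0" using s by (simp add: b_def K_def)
      then show ?thesis by simp
    qed
  qed
  finally show ?thesis by simp
qed

lemma energy_localise:
  "energy (Suc k) f = (\<Sum>r\<in>K k. \<Sum>s | s \<in> K (Suc k) \<and> r \<subseteq> s. \<Sum>s' | s' \<in> K (Suc k) \<and> r \<subseteq> s'.
     b s s' * (f s - f s')\<^sup>2)"
proof -
  have "energy (Suc k) f = (\<Sum>s\<in>K (Suc k). \<Sum>r | r \<in> K k \<and> r \<subseteq> s.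
      \<Sum>s' | s' \<in> K (Suc k) \<and> r \<subseteq> s'. b s s' * (f s - f s')\<^sup>2)"
    unfolding energy_def by (intro sum.cong refl sum_b_localise)
  also have "\<dots> = (\<Sum>r\<in>K k. \<Sum>s | s \<in> K (Suc k) \<and> r \<subseteq> s. \<Sum>s' | s' \<in> K (Suc k) \<and> r \<subseteq> s'.
     b s s' * (f s - f s')\<^sup>2)"
    by (rule sum_swap_incident)
  finally show ?thesis .
qed

lemma sibling_face:
  assumes r: "r \<in> K k" and s: "s \<in> K (Suc k)" and rs: "r \<subseteq> s"
    and s': "s' \<in> K (Suc k)" and rs': "r \<subseteq> s'" and ne: "s' \<noteq> s"
  obtains v where "v \<in> V" "v \<notin> s" "v \<notin> r" "s' = insert v r" "s \<union> s' = insert v s"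
proof -
  have "card (s' - r) = 1"
    using s' r rs' K_finite[OF r] by (simp add: card_Diff_subset K_def)
  then obtain v where v: "s' - r = {v}" by (auto simp: card_1_singleton_iff)
  then have s'v: "s' = insert v r" "v \<notin> r" using rs' by auto
  moreover have "v \<notin> s"
  proof
    assume "v \<in> s"
    then have "s' \<subseteq> s" using s'v rs by auto
    then show False using card_subset_eq[OF K_finite[OF s]] s' s ne by (auto simp: K_def)
  qed
  ultimately show ?thesis using that s' rs by (auto simp: K_def)
qed

text \<open>The map from \<open>s'\<close> to its union with \<open>s\<close> is a bijection onto
  the supersets of \<open>s\<close> with one more element; its inverse removes \<open>s\<close> and
  adds \<open>r\<close>. The resulting degree does not depend on \<open>r\<close>.\<close>

lemma local_row_sum:
  assumes r: "r \<in> K k" and s: "s \<in> K (Suc k)" and rs: "r \<subseteq> s"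
  shows "(\<Sum>s' | s' \<in> K (Suc k) \<and> r \<subseteq> s'. b s s') = (real d - real k) * w s"
proof -
  have fs: "finite s" and fr: "finite r" using r s K_finite by auto
  have cs: "card s = Suc k" and cr: "card r = k" using r s by (auto simp: K_def)
  have "(\<Sum>s' | s' \<in> K (Suc k) \<and> r \<subseteq> s'. b s s')
     = (\<Sum>s' | s' \<in> K (Suc k) \<and> r \<subseteq> s' \<and> s' \<noteq> s. b s s')"
    by (intro sum.mono_neutral_right) auto
  also have "\<dots> = (\<Sum>t | t \<in> K (Suc (Suc k)) \<and> s \<subseteq> t. w t)"
  proof (rule sum.reindex_bij_witness[where i = "\<lambda>t. r \<union> (t - s)" and j = "\<lambda>s'. s \<union> s'"])
    fix s' assume "s' \<in> {s'. s' \<in> K (Suc k) \<and> r \<subseteq> s' \<and> s' \<noteq> s}"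
    then have s': "s' \<in> K (Suc k)" "r \<subseteq> s'" "s' \<noteq> s" by auto
    obtain v where v: "v \<in> V" "v \<notin> s" "s' = insert v r" and U: "s \<union> s' = insert v s"
      using sibling_face[OF r s rs s'] .
    show "r \<union> ((s \<union> s') - s) = s'" using v rs by auto
    show "s \<union> s' \<in> {t. t \<in> K (Suc (Suc k)) \<and> s \<subseteq> t}"
      using v fs cs s unfolding K_def mem_Collect_eq U by auto
    show "w (s \<union> s') = b s s'" using U v fs by (simp add: b_def)
  next
    fix t assume "t \<in> {t. t \<in> K (Suc (Suc k)) \<and> s \<subseteq> t}"
    then have t: "t \<in> K (Suc (Suc k))" "s \<subseteq> t" by auto
    show "s \<union> (r \<union> (t - s)) = t" using t rs by auto
    have "card (t - s) = 1" using t fs cs by (simp add: card_Diff_subset K_def)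
    then obtain v where v: "t - s = {v}" by (auto simp: card_1_singleton_iff)
    then have "v \<notin> s" "v \<notin> r" using rs by auto
    then show "r \<union> (t - s) \<in> {s'. s' \<in> K (Suc k) \<and> r \<subseteq> s' \<and> s' \<noteq> s}"
      using v fr cr r t by (auto simp: K_def)
  qed
  also have "\<dots> = (real d - real k) * w s" using sum_w_up[OF s] by simp
  finally show ?thesis .
qed

lemma row_sum:
  assumes s: "s \<in> K (Suc k)"
  shows "(\<Sum>s'\<in>K (Suc k). b s s') = (real k + 1) * (real d - real k) * w s"
proof -
  have "(\<Sum>s'\<in>K (Suc k). b s s') = (\<Sum>r | r \<in> K k \<and> r \<subseteq> s. \<Sum>s' | s' \<in> K (Suc k) \<and> r \<subseteq> s'. b s s')"
    using sum_b_localise[OF s, of "\<lambda>_. 1"] by simp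
  also have "\<dots> = (\<Sum>r | r \<in> K k \<and> r \<subseteq> s. (real d - real k) * w s)"
    using s by (intro sum.cong refl local_row_sum) auto
  also have "\<dots> = (real k + 1) * (real d - real k) * w s"
    by (simp add: card_facets[OF s])
  finally show ?thesis .
qed


section \<open>Averaging over cofaces and induction on the dimension\<close>

text \<open>A conditional expectation: by \<open>sum_w_up\<close> the denominator is the total
  weight above \<open>r\<close>. If \<open>w r\<close> = 0 the value is 0, which is harmless since
  all weights above \<open>r\<close> vanish as well.\<close>

definition avg :: "nat \<Rightarrow> ('v set \<Rightarrow> real) \<Rightarrow> 'v set \<Rightarrow> real" where
  "avg k f r = (\<Sum>s | s \<in> K (Suc k) \<and> r \<subseteq> s. w s * f s) / ((real d + 1 - real k) * w r)"

lemma avg_mult: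
  assumes r: "r \<in> K k" and k: "k \<le> d"
  shows "(real d + 1 - real k) * w r * avg k f r = (\<Sum>s | s \<in> K (Suc k) \<and> r \<subseteq> s. w s * f s)"
proof (cases "w r = 0")
  case True
  then have "w s = 0" if "r \<subseteq> s" for s
    using w_antimono[OF that] w_nonneg[of s] by simp
  then show ?thesis using True by simp
next
  case False
  then show ?thesis using k by (simp add: avg_def)
qed

text \<open>Up to scale, \<open>avg\<close> is the adjoint of summation over facets. Taking
  \<open>g\<close> constant shows that averaging preserves mean zero.\<close>

lemma avg_adjoint:
  assumes k: "k \<le> d"
  shows "(real d + 1 - real k) * (\<Sum>r\<in>K k. w r * (avg k f r * g r))
    = (\<Sum>s\<in>K (Suc k). w s * f s * (\<Sum>r | r \<in> K k \<and> r \<subseteq> s. g r))"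
proof -
  have "(real d + 1 - real k) * (\<Sum>r\<in>K k. w r * (avg k f r * g r))
      = (\<Sum>r\<in>K k. (real d + 1 - real k) * w r * avg k f r * g r)"
    by (simp add: sum_distrib_left mult_ac)
  also have "\<dots> = (\<Sum>r\<in>K k. \<Sum>s | s \<in> K (Suc k) \<and> r \<subseteq> s. w s * f s * g r)"
    by (rule sum.cong[OF refl]) (simp only: avg_mult[OF _ k] sum_distrib_right)
  also have "\<dots> = (\<Sum>s\<in>K (Suc k). \<Sum>r | r \<in> K k \<and> r \<subseteq> s. w s * f s * g r)"
    by (rule sum_swap_incident[symmetric])
  finally show ?thesis by (simp add: sum_distrib_left)
qed

lemma local_mean_zero:
  assumes r: "r \<in> K k" and k: "k \<le> d"
  shows "(\<Sum>s | s \<in> K (Suc k) \<and> r \<subseteq> s. w s * (f s - avg k f r)) = 0"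
proof -
  have "(\<Sum>s | s \<in> K (Suc k) \<and> r \<subseteq> s. w s * (f s - avg k f r))
      = (\<Sum>s | s \<in> K (Suc k) \<and> r \<subseteq> s. w s * f s) - (\<Sum>s | s \<in> K (Suc k) \<and> r \<subseteq> s. w s) * avg k f r"
    by (simp add: algebra_simps sum_subtractf sum_distrib_left)
  then show ?thesis using avg_mult[OF assms, of f] sum_w_up[OF r] by simp
qed

lemma local_variance:
  assumes r: "r \<in> K k" and k: "k \<le> d"
  shows "(\<Sum>s | s \<in> K (Suc k) \<and> r \<subseteq> s. w s * (f s - avg k f r)\<^sup>2)
    = (\<Sum>s | s \<in> K (Suc k) \<and> r \<subseteq> s. w s * (f s)\<^sup>2) - (real d + 1 - real k) * (w r * (avg k f r)\<^sup>2)"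
proof -
  define c where "c = avg k f r"
  have "(\<Sum>s | s \<in> K (Suc k) \<and> r \<subseteq> s. w s * (f s - c)\<^sup>2)
      = (\<Sum>s | s \<in> K (Suc k) \<and> r \<subseteq> s. w s * (f s)\<^sup>2 - 2 * c * (w s * f s) + c\<^sup>2 * w s)"
    by (rule sum.cong[OF refl]) (simp add: power2_eq_square algebra_simps)
  also have "\<dots> = (\<Sum>s | s \<in> K (Suc k) \<and> r \<subseteq> s. w s * (f s)\<^sup>2)
      - 2 * c * (\<Sum>s | s \<in> K (Suc k) \<and> r \<subseteq> s. w s * f s) + c\<^sup>2 * (\<Sum>s | s \<in> K (Suc k) \<and> r \<subseteq> s. w s)"
    by (simp add: sum.distrib sum_subtractf sum_distrib_left)
  also have "\<dots> = (\<Sum>s | s \<in> K (Suc k) \<and> r \<subseteq> s. w s * (f s)\<^sup>2) - (real d + 1 - real k) * (w r * c\<^sup>2)"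
    unfolding avg_mult[OF assms, of f, symmetric] sum_w_up[OF r] c_def[symmetric]
    by (simp add: power2_eq_square algebra_simps)
  finally show ?thesis by (simp add: c_def)
qed

lemma sum_sqnorm_links:
  "(\<Sum>r\<in>K k. \<Sum>s | s \<in> K (Suc k) \<and> r \<subseteq> s. w s * (f s)\<^sup>2) = (real k + 1) * sqnorm (Suc k) f"
proof -
  have "(\<Sum>r\<in>K k. \<Sum>s | s \<in> K (Suc k) \<and> r \<subseteq> s. w s * (f s)\<^sup>2)
      = (\<Sum>s\<in>K (Suc k). \<Sum>r | r \<in> K k \<and> r \<subseteq> s. w s * (f s)\<^sup>2)"
    by (rule sum_swap_incident[symmetric])
  also have "\<dots> = (\<Sum>s\<in>K (Suc k). (real k + 1) * (w s * (f s)\<^sup>2))"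
    by (rule sum.cong[OF refl]) (simp add: card_facets)
  finally show ?thesis by (simp add: sqnorm_def sum_distrib_left)
qed

text \<open>Here \<open>z\<close> is a lower bound for the gap of all link graphs. The energy is at
  least 2 z (d - n) times the sum of the local variances, that is, of (n + 1) |f|^2 - D |g|^2 with
  \<open>g\<close> the average of \<open>f\<close>. The induction hypothesis for \<open>g\<close>
  yields D |g|^2 \<le> (n + 1 - z^n) |f|^2, so that z^n |f|^2 remains. Dividing by the full degree,
  which has a further factor k + 1, gives the gap z^(k+1) / (k + 1).\<close>

lemma local_to_global_gap:
  assumes z: "0 \<le> z" "z \<le> 1"
    and local_gap: "\<And>k r f c. k < d \<Longrightarrow> r \<in> K k \<Longrightarrow>
      (\<Sum>s | s \<in> K (Suc k) \<and> r \<subseteq> s. w s * (f s - c)) = 0 \<Longrightarrow>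
      2 * z * (real d - real k) * (\<Sum>s | s \<in> K (Suc k) \<and> r \<subseteq> s. w s * (f s - c)\<^sup>2)
        \<le> (\<Sum>s | s \<in> K (Suc k) \<and> r \<subseteq> s. \<Sum>s' | s' \<in> K (Suc k) \<and> r \<subseteq> s'. b s s' * (f s - f s')\<^sup>2)"
    and k: "k < d" and mean: "(\<Sum>s\<in>K (Suc k). w s * f s) = 0"
  shows "2 * z ^ Suc k * (real d - real k) * sqnorm (Suc k) f \<le> energy (Suc k) f"
  using k mean
proof (induction k arbitrary: f)
  case 0
  have K0: "K 0 = {{}}" by (auto simp: K_def dest: finite_subset[OF _ finV])
  show ?case
    \<comment> \<open>The only set of size 0 is empty, and global mean zero is the local hypothesis
      with c = 0.\<close>
    using local_gap[of 0 "{}" f 0] 0 by (simp add: energy_localise K0 sqnorm_def)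
next
  case (Suc k)
  define n where "n = Suc k"
  define g where "g = avg n f"
  define G where "G s = (\<Sum>r | r \<in> K n \<and> r \<subseteq> s. g r)" for s
  define D where "D = real d + 1 - real n"
  have nd: "n \<le> d" using Suc.prems by (simp add: n_def)
  have D: "0 < D" using nd by (simp add: D_def)
  have adj: "D * sqnorm n g = (\<Sum>s\<in>K (Suc n). w s * f s * G s)"
    using avg_adjoint[OF nd, of f g]
    by (simp add: sqnorm_def D_def G_def g_def power2_eq_square)
  have "D * (\<Sum>r\<in>K n. w r * g r) = (\<Sum>s\<in>K (Suc n). w s * f s * (real n + 1))"
    using avg_adjoint[OF nd, of f "\<lambda>_. 1"] card_facets by (simp add: D_def g_def add.commute cong: sum.cong)
  also have "\<dots> = 0"
    using Suc.prems(2) by (simp add: sum_distrib_right[symmetric] n_def)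
  finally have "(\<Sum>r\<in>K n. w r * g r) = 0" using D by simp
  then have IH: "2 * z ^ n * D * sqnorm n g \<le> energy n g"
    using Suc.IH[of g] Suc.prems by (simp add: n_def D_def)
  have "(\<Sum>s\<in>K (Suc n). w s * (G s)\<^sup>2) = (real n + 1) * D * sqnorm n g - energy n g / 2"
    unfolding G_def D_def by (rule facet_sums_sqnorm)
  then have G: "(\<Sum>s\<in>K (Suc n). w s * (G s)\<^sup>2) \<le> D * (real n + 1 - z ^ n) * sqnorm n g"
    using IH by (simp add: algebra_simps)
  define e where "e = real n + 1 - z ^ n"
  have e: "0 < e" using power_le_one[OF z, of n] by (simp add: e_def n_def)
  \<comment> \<open>This choice minimises the bound obtained below for the squared norm of f - t G.
    Its nonnegativity carries the norm bound for facet sums over to the adjoint.\<close>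
  define t where "t = 1 / e"
  have "0 \<le> (\<Sum>s\<in>K (Suc n). w s * (f s - t * G s)\<^sup>2)"
    by (simp add: sum_nonneg)
  also have "\<dots> = (\<Sum>s\<in>K (Suc n). w s * (f s)\<^sup>2 - 2 * t * (w s * f s * G s) + t\<^sup>2 * (w s * (G s)\<^sup>2))"
    by (rule sum.cong[OF refl]) (simp add: power2_eq_square algebra_simps)
  also have "\<dots> = sqnorm (Suc n) f - 2 * t * (D * sqnorm n g) + t\<^sup>2 * (\<Sum>s\<in>K (Suc n). w s * (G s)\<^sup>2)"
    by (simp add: sum.distrib sum_subtractf sum_distrib_left[symmetric] adj sqnorm_def[of "Suc n"])
  also have "\<dots> \<le> sqnorm (Suc n) f - 2 * t * (D * sqnorm n g) + t\<^sup>2 * (D * e * sqnorm n g)"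
    using G by (intro add_left_mono mult_left_mono) (auto simp: e_def)
  also have "\<dots> = sqnorm (Suc n) f - D * sqnorm n g / e"
    using e by (simp add: t_def power2_eq_square)
  finally have key: "D * sqnorm n g \<le> e * sqnorm (Suc n) f"
    using e by (simp add: field_simps)
  have "2 * z ^ Suc n * (real d - real n) * sqnorm (Suc n) f
      = 2 * z * (real d - real n) * ((real n + 1) * sqnorm (Suc n) f - e * sqnorm (Suc n) f)"
    by (simp add: e_def algebra_simps)
  also have "\<dots> \<le> 2 * z * (real d - real n) * ((real n + 1) * sqnorm (Suc n) f - D * sqnorm n g)"
    using key z nd by (intro mult_left_mono) auto
  also have "\<dots> = (\<Sum>r\<in>K n. 2 * z * (real d - real n) * (\<Sum>s | s \<in> K (Suc n) \<and> r \<subseteq> s. w s * (f s - g r)\<^sup>2))"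
    by (simp add: g_def local_variance[OF _ nd] sum_distrib_left[symmetric] sum_subtractf
        sum_sqnorm_links D_def sqnorm_def cong: sum.cong)
  also have "\<dots> \<le> energy (Suc n) f"
    unfolding energy_localise g_def using Suc.prems
    by (intro sum_mono local_gap local_mean_zero) (auto simp: n_def)
  finally show ?case by (simp add: n_def)
qed

text \<open>Positivity of the left side of \<open>facet_sums_sqnorm\<close>. An upper bound on
  energy is a lower bound on the spectrum of the walk.\<close>

lemma energy_upper: "energy k f \<le> 2 * ((real k + 1) * (real d + 1 - real k) * sqnorm k f)"
proof -
  have "0 \<le> (\<Sum>t\<in>K (Suc k). w t * (\<Sum>s | s \<in> K k \<and> s \<subseteq> t. f s)\<^sup>2)"
    by (simp add: sum_nonneg)
  then show ?thesis unfolding facet_sums_sqnorm by simp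
qed

lemma quadratic_form:
  "(\<Sum>s\<in>K (Suc k). \<Sum>s'\<in>K (Suc k). b s s' * (f s * f s'))
    = (real k + 1) * (real d - real k) * sqnorm (Suc k) f - energy (Suc k) f / 2"
proof -
  have fst: "(\<Sum>s\<in>K (Suc k). \<Sum>s'\<in>K (Suc k). b s s' * (f s)\<^sup>2)
      = (real k + 1) * (real d - real k) * sqnorm (Suc k) f"
    unfolding sqnorm_def sum_distrib_left sum_distrib_right[symmetric]
    by (rule sum.cong[OF refl]) (simp add: row_sum)
  have "(\<Sum>s\<in>K (Suc k). \<Sum>s'\<in>K (Suc k). b s s' * (f s')\<^sup>2)
      = (\<Sum>s'\<in>K (Suc k). \<Sum>s\<in>K (Suc k). b s s' * (f s')\<^sup>2)" by (rule sum.swap)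
  also have "\<dots> = (\<Sum>s'\<in>K (Suc k). \<Sum>s\<in>K (Suc k). b s' s * (f s')\<^sup>2)"
    by (intro sum.cong refl) (simp add: b_sym)
  finally have snd: "(\<Sum>s\<in>K (Suc k). \<Sum>s'\<in>K (Suc k). b s s' * (f s')\<^sup>2)
      = (real k + 1) * (real d - real k) * sqnorm (Suc k) f" by (simp add: fst)
  have "energy (Suc k) f = (\<Sum>s\<in>K (Suc k). \<Sum>s'\<in>K (Suc k).
      b s s' * (f s)\<^sup>2 + b s s' * (f s')\<^sup>2 - 2 * (b s s' * (f s * f s')))"
    unfolding energy_def by (intro sum.cong refl) (simp add: power2_eq_square algebra_simps)
  also have "\<dots> = 2 * ((real k + 1) * (real d - real k) * sqnorm (Suc k) f)
      - 2 * (\<Sum>s\<in>K (Suc k). \<Sum>s'\<in>K (Suc k). b s s' * (f s * f s'))"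
    by (simp add: sum.distrib sum_subtractf fst snd sum_distrib_left[symmetric])
  finally show ?thesis by (simp add: diff_divide_distrib)
qed

end

section \<open>Links of a skeleton expander\<close>

lemma mem_link_iff: "s \<in> link X r \<longleftrightarrow> s \<inter> r = {} \<and> s \<union> r \<in> X"
proof
  assume "s \<in> link X r"
  then obtain t where "s = t - r" "t \<in> X" "r \<subseteq> t" by (auto simp: link_def)
  moreover from this have "s \<union> r = t" by auto
  ultimately show "s \<inter> r = {} \<and> s \<union> r \<in> X" by auto
next
  assume "s \<inter> r = {} \<and> s \<union> r \<in> X"
  moreover from this have "s = (s \<union> r) - r" by auto
  ultimately show "s \<in> link X r" unfolding link_def by blast
qed

locale pure_simplicial_complex =
  fixes V :: "'v set" and X :: "'v set set" and d :: nat
  assumes complex: "simplicial_complex V X"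
    and pure: "pure_complex X"
    and dim: "complex_dim X = int d"
begin

lemma face_subset: "s \<in> X \<Longrightarrow> s \<subseteq> V"
  and face_down: "s \<in> X \<Longrightarrow> r \<subseteq> s \<Longrightarrow> r \<in> X"
  and fin_vertices: "finite V"
  using complex by (auto simp: simplicial_complex_def)

lemma face_finite: "s \<in> X \<Longrightarrow> finite s"
  using face_subset fin_vertices finite_subset by blast

lemma fin_faces: "finite X"
  using face_subset fin_vertices by (meson Pow_iff finite_Pow_iff finite_subset subsetI)

sublocale uniform_hypergraph V "faces X (int d)" d
proof
  show "finite V" by (rule fin_vertices)
  show "faces X (int d) \<subseteq> Pow V" using face_subset by (auto simp: faces_def)
  show "card t = Suc d" if "t \<in> faces X (int d)" for t
    using that by (simp add: faces_def face_dim_def)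
qed

lemma face_deg_eq: "real (face_deg X s) = w s"
  by (simp add: face_deg_def w_def dim)

lemma w_nonface: "s \<notin> X \<Longrightarrow> w s = 0"
  unfolding w_def using face_down by (auto simp: faces_def card_eq_0_iff)

lemma w_face_pos: "s \<in> X \<Longrightarrow> 0 < w s"
  using pure dim by (auto simp: pure_complex_def w_def card_gt_0_iff)

lemma card_face_le: "s \<in> X \<Longrightarrow> card s \<le> Suc d"
  using dim Max_ge[of "face_dim ` X" "face_dim s"] fin_faces
  by (simp add: complex_dim_def face_dim_def)

lemma faces_eq: "faces X (int k) = K (Suc k) \<inter> X"
  using face_subset by (auto simp: faces_def K_def face_dim_def)

text \<open>Indexing by the size \<open>m\<close> lets one formula serve the vertices, edges and top
  faces of a link, including m = 0 for the link of a top face.\<close>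

lemma faces_link_eq:
  assumes r: "r \<in> K j"
  shows "faces (link X r) (int m - 1) = (\<lambda>s. s - r) ` ({s \<in> K (j + m). r \<subseteq> s} \<inter> X)"
proof (intro equalityI subsetI)
  fix s assume "s \<in> faces (link X r) (int m - 1)"
  then have s: "s \<inter> r = {}" "s \<union> r \<in> X" "card s = m"
    by (auto simp: faces_def face_dim_def mem_link_iff)
  then have "finite s" using face_finite by blast
  then have "s \<union> r \<in> K (j + m)"
    using s r K_finite[OF r] face_subset[of "s \<union> r"] by (simp add: K_def card_Un_disjoint)
  moreover have "s = (s \<union> r) - r" using s by auto
  ultimately show "s \<in> (\<lambda>s. s - r) ` ({s \<in> K (j + m). r \<subseteq> s} \<inter> X)" using s by blast
next
  fix s assume "s \<in> (\<lambda>s. s - r) ` ({s \<in> K (j + m). r \<subseteq> s} \<inter> X)"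
  then obtain t where t: "s = t - r" "t \<in> K (j + m)" "r \<subseteq> t" "t \<in> X" by auto
  then have "card s = m" "s \<union> r = t"
    using r K_finite[OF r] by (auto simp: card_Diff_subset K_def)
  then show "s \<in> faces (link X r) (int m - 1)"
    using t by (auto simp: faces_def face_dim_def mem_link_iff)
qed

text \<open>Purity makes the dimension exact, as \<open>r\<close> extends to a top face. The natural
  subtraction is exact because j \<le> d + 1.\<close>

lemma complex_dim_link:
  assumes "r \<in> X" "r \<in> K j"
  shows "complex_dim (link X r) = int (Suc d - j) - 1"
  unfolding complex_dim_def
proof (rule Max_eqI)
  have "link X r \<subseteq> (\<lambda>t. t - r) ` X" by (auto simp: link_def)
  then show "finite (face_dim ` link X r)" using fin_faces finite_subset by blast
  have jd: "j \<le> Suc d" using card_face_le[OF assms(1)] assms(2) by (simp add: K_def)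
  show "y \<le> int (Suc d - j) - 1" if y: "y \<in> face_dim ` link X r" for y
  proof -
    from y obtain t where t: "y = face_dim (t - r)" "t \<in> X" "r \<subseteq> t" by (auto simp: link_def)
    then show ?thesis
      using card_face_le[of t] assms K_finite[OF assms(2)] jd
      by (simp add: face_dim_def card_Diff_subset K_def)
  qed
  obtain t where t: "t \<in> faces X (int d)" "r \<subseteq> t"
    using pure dim assms by (auto simp: pure_complex_def)
  then have "t - r \<in> link X r" by (auto simp: link_def faces_def)
  moreover have "face_dim (t - r) = int (Suc d - j) - 1"
    using t cardT[OF t(1)] assms K_finite[OF assms(2)]
    by (simp add: face_dim_def card_Diff_subset K_def)
  ultimately show "int (Suc d - j) - 1 \<in> face_dim ` link X r" by force
qed

text \<open>Removing \<open>r\<close> matches the top faces above \<open>s\<close> with those of the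
  link above \<open>s - r\<close>. Norms inside links can therefore be computed with the global
  weight \<open>w\<close>.\<close>

lemma face_deg_link:
  assumes "r \<in> X" "r \<in> K j" "r \<subseteq> s"
  shows "real (face_deg (link X r) (s - r)) = w s"
proof -
  have jd: "j + (Suc d - j) = Suc d" using card_face_le[OF assms(1)] assms(2) by (simp add: K_def)
  have "{t \<in> faces (link X r) (complex_dim (link X r)). s - r \<subseteq> t}
      = (\<lambda>t. t - r) ` {t \<in> faces X (int d). s \<subseteq> t}"
    unfolding complex_dim_link[OF assms(1,2)] faces_link_eq[OF assms(2)] jd
    using assms(3) by (auto simp: faces_eq)
  moreover have "inj_on (\<lambda>t. t - r) {t \<in> faces X (int d). s \<subseteq> t}"
    using assms(3) by (intro inj_onI) blast
  ultimately show ?thesis by (simp add: face_deg_def w_def card_image)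
qed

lemma sum_face_deg_link:
  assumes "r \<in> X" "r \<in> K j" and A: "finite A" "\<And>s. s \<in> A \<Longrightarrow> r \<subseteq> s"
  shows "(\<Sum>s\<in>(\<lambda>s. s - r) ` (A \<inter> X). real (face_deg (link X r) s)) = (\<Sum>s\<in>A. w s)"
proof -
  have "inj_on (\<lambda>t. t - r) (A \<inter> X)" using A(2) by (intro inj_onI) blast
  then have "(\<Sum>s\<in>(\<lambda>s. s - r) ` (A \<inter> X). real (face_deg (link X r) s)) = (\<Sum>s\<in>A \<inter> X. w s)"
    using A(2) by (simp add: sum.reindex face_deg_link[OF assms(1,2)])
  also have "\<dots> = (\<Sum>s\<in>A. w s)"
    using A(1) w_nonface by (intro sum.mono_neutral_left) auto
  finally show ?thesis .
qed

section \<open>Skeleton expansion as a bound on conductance\<close>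

text \<open>Each edge of the link has two endpoints. The identity relates the denominators of the
  norms on edges and on vertices.\<close>

lemma link_edge_weight:
  assumes r: "r \<in> K j"
  shows "2 * (\<Sum>t | t \<in> K (Suc (Suc j)) \<and> r \<subseteq> t. w t) = (real d - real j) * (\<Sum>s | s \<in> K (Suc j) \<and> r \<subseteq> s. w s)"
proof -
  have "(real d - real j) * (\<Sum>s | s \<in> K (Suc j) \<and> r \<subseteq> s. w s)
      = (\<Sum>s | s \<in> K (Suc j) \<and> r \<subseteq> s. \<Sum>t | t \<in> K (Suc (Suc j)) \<and> s \<subseteq> t. w t)"
    unfolding sum_distrib_left by (rule sum.cong[OF refl]) (simp add: sum_w_up)
  also have "\<dots> = (\<Sum>s | s \<in> K (Suc j) \<and> r \<subseteq> s. \<Sum>t | t \<in> {t \<in> K (Suc (Suc j)). r \<subseteq> t} \<and> s \<subseteq> t. w t)"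
    by (rule sum.cong[OF refl], rule sum.cong) auto
  also have "\<dots> = (\<Sum>t | t \<in> K (Suc (Suc j)) \<and> r \<subseteq> t. \<Sum>s | s \<in> {s \<in> K (Suc j). r \<subseteq> s} \<and> s \<subseteq> t. w t)"
    using sum.swap_restrict[of "{s \<in> K (Suc j). r \<subseteq> s}" "{t \<in> K (Suc (Suc j)). r \<subseteq> t}"
        "\<lambda>s t. w t" "\<lambda>s t. s \<subseteq> t"] by simp
  also have "\<dots> = (\<Sum>t | t \<in> K (Suc (Suc j)) \<and> r \<subseteq> t. 2 * w t)"
  proof (rule sum.cong[OF refl])
    fix t assume "t \<in> {t. t \<in> K (Suc (Suc j)) \<and> r \<subseteq> t}"
    then have t: "t \<in> K (Suc (Suc j))" "r \<subseteq> t" by auto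
    have "{s. s \<in> {s \<in> K (Suc j). r \<subseteq> s} \<and> s \<subseteq> t} = {s. r \<subseteq> s \<and> s \<subseteq> t \<and> card s = Suc (card r)}"
      using t r by (auto simp: K_def)
    then have "card {s. s \<in> {s \<in> K (Suc j). r \<subseteq> s} \<and> s \<subseteq> t} = 2"
      using card_sets_between_Suc[OF K_finite[OF t(1)] t(2)] t r by (simp add: K_def)
    then show "(\<Sum>s | s \<in> {s \<in> K (Suc j). r \<subseteq> s} \<and> s \<subseteq> t. w t) = 2 * w t" by simp
  qed
  finally show ?thesis by (simp add: sum_distrib_left)
qed

text \<open>\<open>B\<close> consists of the link edges with both endpoints in \<open>S\<close>, a
  link vertex v being represented by \<open>insert v r\<close>. Each edge comes from at most two
  ordered pairs.\<close>

lemma inner_weight_le: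
  assumes r: "r \<in> K j" and S: "S \<subseteq> {s \<in> K (Suc j). r \<subseteq> s}"
  defines "B \<equiv> {t \<in> K (Suc (Suc j)). r \<subseteq> t \<and> (\<forall>s\<in>K (Suc j). r \<subseteq> s \<and> s \<subseteq> t \<longrightarrow> s \<in> S)}"
  shows "(\<Sum>s\<in>S. \<Sum>s'\<in>S. b s s') \<le> 2 * (\<Sum>t\<in>B. w t)"
proof -
  have finS: "finite S" using S by (rule finite_subset) simp
  have finB: "finite B" by (simp add: B_def)
  have "(\<Sum>s\<in>S. \<Sum>s'\<in>S. b s s') \<le> (\<Sum>s\<in>S. \<Sum>t | t \<in> B \<and> s \<subseteq> t. w t)"
  proof (rule sum_mono)
    fix s assume s: "s \<in> S"
    then have sK: "s \<in> K (Suc j)" "r \<subseteq> s" using S by auto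
    have sib: "\<exists>v. v \<in> V \<and> v \<notin> s \<and> v \<notin> r \<and> s' = insert v r \<and> s \<union> s' = insert v s" if "s' \<in> S - {s}" for s'
      using sibling_face[OF r sK, of s'] that S by blast
    have "(\<Sum>s'\<in>S. b s s') = (\<Sum>s'\<in>S - {s}. b s s')"
      using finS by (intro sum.mono_neutral_right) auto
    also have "\<dots> \<le> (\<Sum>s'\<in>S - {s}. w (s \<union> s'))"
      by (intro sum_mono) (auto simp: b_def)
    also have "\<dots> = (\<Sum>t\<in>(\<lambda>s'. s \<union> s') ` (S - {s}). w t)"
    proof (subst sum.reindex)
      show "inj_on (\<lambda>s'. s \<union> s') (S - {s})"
      proof (rule inj_on_inverseI[where g = "\<lambda>t. r \<union> (t - s)"])
        fix x assume "x \<in> S - {s}"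
        from sib[OF this] show "r \<union> (s \<union> x - s) = x" using sK by auto
      qed
    qed simp
    also have "\<dots> \<le> (\<Sum>t | t \<in> B \<and> s \<subseteq> t. w t)"
    proof (rule sum_mono2)
      show "finite {t. t \<in> B \<and> s \<subseteq> t}" using finB by simp
      show "(\<lambda>s'. s \<union> s') ` (S - {s}) \<subseteq> {t. t \<in> B \<and> s \<subseteq> t}"
      proof (rule image_subsetI)
        fix s' assume s': "s' \<in> S - {s}"
        with sib obtain v where v: "v \<in> V" "v \<notin> s" "v \<notin> r" "s' = insert v r" "s \<union> s' = insert v s"
          by metis
        have tK: "insert v s \<in> K (Suc (Suc j))"
          using v sK K_finite[OF sK(1)] by (simp add: K_def)
        have "x \<in> S" if x: "x \<in> K (Suc j)" "r \<subseteq> x" "x \<subseteq> insert v s" for x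
        proof (cases "v \<in> x")
          case True
          then have "s' \<subseteq> x" using v x by auto
          then have "s' = x"
            using card_subset_eq[OF K_finite[OF x(1)], of s'] x s' S unfolding K_def by auto
          then show ?thesis using s' by simp
        next
          case False
          then have "x \<subseteq> s" using x by auto
          then have "x = s" using card_subset_eq[OF K_finite[OF sK(1)]] x sK by (auto simp: K_def)
          then show ?thesis using s by simp
        qed
        then show "s \<union> s' \<in> {t. t \<in> B \<and> s \<subseteq> t}"
          using v(5) tK sK by (auto simp: B_def)
      qed
    qed simp
    finally show "(\<Sum>s'\<in>S. b s s') \<le> (\<Sum>t | t \<in> B \<and> s \<subseteq> t. w t)" .
  qed
  also have "\<dots> = (\<Sum>t\<in>B. \<Sum>s | s \<in> S \<and> s \<subseteq> t. w t)"
    using finS finB by (rule sum.swap_restrict)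
  also have "\<dots> \<le> (\<Sum>t\<in>B. 2 * w t)"
  proof (rule sum_mono)
    fix t assume "t \<in> B"
    then have t: "t \<in> K (Suc (Suc j))" "r \<subseteq> t" by (auto simp: B_def)
    have "card {s. s \<in> S \<and> s \<subseteq> t} \<le> card {s. r \<subseteq> s \<and> s \<subseteq> t \<and> card s = Suc (card r)}"
      using S r K_finite[OF t(1)] by (intro card_mono) (auto simp: K_def)
    also have "\<dots> = 2"
      using card_sets_between_Suc[OF K_finite[OF t(1)] t(2)] t r by (simp add: K_def)
    finally show "(\<Sum>s | s \<in> S \<and> s \<subseteq> t. w t) \<le> 2 * w t"
      by (simp add: mult_right_mono)
  qed
  finally show ?thesis by (simp add: sum_distrib_left)
qed

text \<open>This is skeleton expansion cleared of its denominators: the 1/2 in W1 = (d - j) W0 / 2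
  cancels the double count of inner edges, and j < d keeps W1 positive.\<close>

lemma expander_inner_weight:
  assumes ex: "skeleton_expander \<alpha> X" and rX: "r \<in> X" and r: "r \<in> K j" and j: "j < d"
    and S: "S \<subseteq> {s \<in> K (Suc j). r \<subseteq> s}"
  shows "(\<Sum>s\<in>S. \<Sum>s'\<in>S. b s s') \<le> (real d - real j) * (\<Sum>s\<in>S. w s) *
    ((\<Sum>s\<in>S. w s) / (\<Sum>s | s \<in> K (Suc j) \<and> r \<subseteq> s. w s) + \<alpha>)"
proof -
  define W0 where "W0 = (\<Sum>s | s \<in> K (Suc j) \<and> r \<subseteq> s. w s)"
  define W1 where "W1 = (\<Sum>t | t \<in> K (Suc (Suc j)) \<and> r \<subseteq> t. w t)"
  \<comment> \<open>\<open>S\<close> may contain non-faces; they carry no weight, so only its part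
    in \<open>X\<close> is handed to the expansion property.\<close>
  define S' where "S' = (\<lambda>s. s - r) ` (S \<inter> X)"
  define wS where "wS = (\<Sum>s\<in>S. w s)"
  define E where "E = (\<Sum>e\<in>inner_edges (link X r) S'. real (face_deg (link X r) e))"
  define B where "B = {t \<in> K (Suc (Suc j)). r \<subseteq> t \<and> (\<forall>s\<in>K (Suc j). r \<subseteq> s \<and> s \<subseteq> t \<longrightarrow> s \<in> S)}"
  have finS: "finite S" using S by (rule finite_subset) simp
  have "W0 = (real d + 1 - real j) * w r" unfolding W0_def by (rule sum_w_up[OF r])
  then have W0: "0 < W0" using j w_face_pos[OF rX] by simp
  have W1: "2 * W1 = (real d - real j) * W0" unfolding W0_def W1_def by (rule link_edge_weight[OF r])
  then have W1pos: "0 < W1" using W0 j by (smt (verit) mult_pos_pos of_nat_less_iff)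
  have f0: "faces (link X r) 0 = (\<lambda>s. s - r) ` ({s \<in> K (Suc j). r \<subseteq> s} \<inter> X)"
    using faces_link_eq[OF r, of 1] by simp
  have f1: "faces (link X r) 1 = (\<lambda>s. s - r) ` ({s \<in> K (Suc (Suc j)). r \<subseteq> s} \<inter> X)"
    using faces_link_eq[OF r, of 2] by simp
  have n0: "face_norm (link X r) 0 S' = wS / W0"
    unfolding face_norm_def f0 S'_def
    using S finS by (subst (1 2) sum_face_deg_link[OF rX r]) (auto simp: wS_def W0_def)
  have n1: "face_norm (link X r) 1 (inner_edges (link X r) S') = E / W1"
    unfolding face_norm_def f1 E_def by (subst sum_face_deg_link[OF rX r]) (auto simp: W1_def)
  have "S' \<subseteq> faces (link X r) 0" using S by (auto simp: S'_def f0)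
  then have "E / W1 \<le> wS / W0 * (wS / W0 + \<alpha>)"
    using ex rX n0 n1 unfolding skeleton_expander_def by metis
  then have "2 * E \<le> 2 * (W1 * (wS / W0 * (wS / W0 + \<alpha>)))"
    using W1pos by (simp add: pos_divide_le_eq mult.commute)
  also have "\<dots> = (2 * W1) * (wS / W0 * (wS / W0 + \<alpha>))" by simp
  also have "\<dots> = (real d - real j) * wS * (wS / W0 + \<alpha>)"
    unfolding W1 using W0 by simp
  finally have E: "2 * E \<le> (real d - real j) * wS * (wS / W0 + \<alpha>)" .
  have "(\<Sum>s\<in>S. \<Sum>s'\<in>S. b s s') \<le> 2 * (\<Sum>t\<in>B. w t)"
    unfolding B_def by (rule inner_weight_le[OF r S])
  also have "(\<Sum>t\<in>B. w t) = (\<Sum>e\<in>(\<lambda>t. t - r) ` (B \<inter> X). real (face_deg (link X r) e))"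
    by (rule sum_face_deg_link[OF rX r, symmetric]) (auto simp: B_def)
  also have "\<dots> \<le> E"
    unfolding E_def
  proof (rule sum_mono2)
    show "finite (inner_edges (link X r) S')"
      unfolding inner_edges_def f1 by simp
    show "(\<lambda>t. t - r) ` (B \<inter> X) \<subseteq> inner_edges (link X r) S'"
    proof (rule image_subsetI)
      fix t assume t: "t \<in> B \<inter> X"
      have "{v} \<in> S'" if v: "v \<in> t - r" for v
      proof -
        have "insert v r \<in> K (Suc j)" "insert v r \<subseteq> t"
          using v t r K_finite[OF r] by (auto simp: B_def K_def)
        then have "insert v r \<in> S \<inter> X" using t face_down[of t] by (auto simp: B_def)
        moreover have "{v} = insert v r - r" using v by auto
        ultimately show ?thesis unfolding S'_def by blast
      qed
      then show "t - r \<in> inner_edges (link X r) S'"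
        using t by (auto simp: inner_edges_def f1 B_def)
    qed
  qed simp
  finally have "(\<Sum>s\<in>S. \<Sum>s'\<in>S. b s s') \<le> 2 * E" by simp
  with E show ?thesis by (simp add: wS_def W0_def)
qed

text \<open>The weight leaving \<open>S\<close> is its degree minus its inner weight. At relative
  mass at most 1/2 the inner weight is at most 1/2 + \<alpha> of the degree, which leaves 1/2 -
  \<alpha>. Above a non-face all weights vanish and only nonnegativity of the right side is
  needed.\<close>

lemma expander_local_gap:
  assumes ex: "skeleton_expander \<alpha> X" and \<alpha>: "\<alpha> < 1 / 2" and j: "j < d" and r: "r \<in> K j"
    and mean: "(\<Sum>s | s \<in> K (Suc j) \<and> r \<subseteq> s. w s * (f s - c)) = 0"
  shows "(1 / 2 - \<alpha>)\<^sup>2 * (real d - real j) * (\<Sum>s | s \<in> K (Suc j) \<and> r \<subseteq> s. w s * (f s - c)\<^sup>2)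
    \<le> (\<Sum>s | s \<in> K (Suc j) \<and> r \<subseteq> s. \<Sum>s' | s' \<in> K (Suc j) \<and> r \<subseteq> s'. b s s' * (f s - f s')\<^sup>2)"
proof (cases "r \<in> X")
  case False
  then have "w s = 0" if "r \<subseteq> s" for s using that face_down w_nonface by blast
  then show ?thesis by (simp add: sum_nonneg)
next
  case True
  define U where "U = {s. s \<in> K (Suc j) \<and> r \<subseteq> s}"
  define m where "m = real d - real j"
  have m: "0 < m" using j by (simp add: m_def)
  have finU: "finite U" by (simp add: U_def)
  have row: "(\<Sum>s'\<in>U. b s s') = m * w s" if "s \<in> U" for s
    using local_row_sum[OF r, of s] that by (simp add: U_def m_def)
  interpret conductance U b "\<lambda>s. m * w s" "1 / 2 - \<alpha>"
  proof
    fix S assume SU: "S \<subseteq> U" and half: "(\<Sum>s\<in>S. m * w s) \<le> (\<Sum>s\<in>U. m * w s) / 2"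
    define wS where "wS = (\<Sum>s\<in>S. w s)"
    define wU where "wU = (\<Sum>s\<in>U. w s)"
    have wS: "0 \<le> wS" by (simp add: wS_def sum_nonneg)
    have wU: "0 \<le> wU" by (simp add: wU_def sum_nonneg)
    have "wS \<le> wU / 2"
      using half m by (simp add: wS_def wU_def sum_distrib_left[symmetric])
    then have ratio: "wS / wU \<le> 1 / 2"
      using wU by (cases "wU = 0") (simp_all add: field_simps)
    have "(\<Sum>s\<in>S. \<Sum>s'\<in>S. b s s') \<le> m * wS * (wS / wU + \<alpha>)"
      using expander_inner_weight[OF ex True r j, of S] SU by (simp add: U_def m_def wS_def wU_def)
    also have "\<dots> \<le> m * wS * (1 / 2 + \<alpha>)"
      using ratio m wS by (intro mult_left_mono) auto
    finally have inner: "(\<Sum>s\<in>S. \<Sum>s'\<in>S. b s s') \<le> m * wS * (1 / 2 + \<alpha>)" .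
    have "(\<Sum>s\<in>S. \<Sum>s'\<in>U - S. b s s') = (\<Sum>s\<in>S. m * w s - (\<Sum>s'\<in>S. b s s'))"
      using finU SU row by (intro sum.cong refl) (auto simp: sum_diff)
    also have "\<dots> = m * wS - (\<Sum>s\<in>S. \<Sum>s'\<in>S. b s s')"
      by (simp add: sum_subtractf sum_distrib_left wS_def)
    finally show "(1 / 2 - \<alpha>) * (\<Sum>s\<in>S. m * w s) \<le> (\<Sum>s\<in>S. \<Sum>s'\<in>U - S. b s s')"
      using inner by (simp add: sum_distrib_left[symmetric] wS_def[symmetric] algebra_simps)
  qed (use finU row \<alpha> b_sym in \<open>auto simp: U_def\<close>)
  have "(\<Sum>s\<in>U. m * w s * (f s - c)) = m * (\<Sum>s\<in>U. w s * (f s - c))"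
    by (simp add: sum_distrib_left mult.assoc)
  then have "(\<Sum>s\<in>U. m * w s * (f s - c)) = 0"
    using mean by (simp add: U_def)
  from cheeger[OF this] show ?thesis
    by (simp add: U_def m_def mult.assoc sum_distrib_left)
qed


section \<open>The walk on faces in terms of the weights\<close>

lemma move_weight:
  assumes "s \<in> faces X (int i)" "s' \<in> faces X (int i)"
  shows "(if s' \<in> neighbors X (int i) s then real (face_deg X (s \<union> s')) else 0) = b s s'"
proof -
  have "card s = Suc i" using assms by (simp add: faces_def face_dim_def)
  moreover have "s' \<in> neighbors X (int i) s \<longleftrightarrow> s \<union> s' \<in> X \<and> card (s \<union> s') = Suc (Suc i)"
    using assms by (auto simp: neighbors_def faces_def face_dim_def)
  ultimately show ?thesis
    using w_nonface[of "s \<union> s'"] by (auto simp: b_def face_deg_eq)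
qed

lemma b_nonface: "s \<notin> X \<or> s' \<notin> X \<Longrightarrow> b s s' = 0"
  using w_nonface[of "s \<union> s'"] face_down[of "s \<union> s'"] by (auto simp: b_def)

lemma sum_b_faces: "(\<Sum>s'\<in>faces X (int i). b s s' * F s') = (\<Sum>s'\<in>K (Suc i). b s s' * F s')"
  using b_nonface by (intro sum.mono_neutral_left) (auto simp: faces_eq)

lemma sum_w_faces: "(\<Sum>s\<in>faces X (int i). w s * F s) = (\<Sum>s\<in>K (Suc i). w s * F s)"
  using w_nonface by (intro sum.mono_neutral_left) (auto simp: faces_eq)

text \<open>On faces of dimension \<open>i\<close> the walk degree is a constant multiple of
  \<open>w\<close>, so the stationary distribution is proportional to \<open>w\<close> and both
  weights have the same mean-zero functions.\<close>

lemma walk_deg_eq: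
  assumes s: "s \<in> faces X (int i)"
  shows "walk_deg X (int i) s = (real i + 1) * (real d - real i) * w s"
proof -
  have fin: "finite (faces X (int i))" by (simp add: faces_eq)
  have "walk_deg X (int i) s = (\<Sum>s'\<in>faces X (int i).
      if s' \<in> neighbors X (int i) s then real (face_deg X (s \<union> s')) else 0)"
    unfolding walk_deg_def using fin
    by (intro sum.mono_neutral_cong_left) (auto simp: neighbors_def)
  also have "\<dots> = (\<Sum>s'\<in>faces X (int i). b s s')"
    using s by (intro sum.cong refl move_weight)
  also have "\<dots> = (\<Sum>s'\<in>K (Suc i). b s s')"
    using sum_b_faces[where F = "\<lambda>_. 1"] by simp
  also have "\<dots> = (real i + 1) * (real d - real i) * w s"
    using s by (intro row_sum) (simp add: faces_eq)
  finally show ?thesis .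
qed

lemma move_prob_eq:
  assumes "s \<in> faces X (int i)" "s' \<in> faces X (int i)"
  shows "move_prob X (int i) s s' = b s s' / walk_deg X (int i) s"
  using move_weight[OF assms] by (auto simp: move_prob_def)

text \<open>The negative part of the spectrum is controlled for free: the up-down walk is positive
  semidefinite and puts weight \<open>1 / (i + 2)\<close> on staying, so all eigenvalues of the
  non-lazy walk are at least \<open>- 1 / (i + 1)\<close>.\<close>

lemma rapidly_mixing_if_gap:
  assumes i: "i < d" and \<mu>: "1 / 2 \<le> \<mu>" "\<mu> < 1"
    and gap: "\<And>f. (\<Sum>s\<in>K (Suc i). w s * f s) = 0 \<Longrightarrow>
      2 * \<gamma> * ((real i + 1) * (real d - real i) * sqnorm (Suc i) f) \<le> energy (Suc i) f"
    and \<gamma>: "i = 0 \<Longrightarrow> 1 - \<gamma> / 2 \<le> \<mu>" "i \<noteq> 0 \<Longrightarrow> 1 - \<gamma> \<le> \<mu>"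
  shows "rapidly_mixing \<mu> X (int i)"
proof -
  define F where "F = faces X (int i)"
  define q where "q = walk_deg X (int i)"
  define D where "D = (real i + 1) * (real d - real i)"
  \<comment> \<open>Holding is put on the diagonal as \<open>q s / 2\<close>, which keeps the kernel
    symmetric with row sums \<open>q\<close>.\<close>
  define c where "c s s' = (if i = 0 then (if s' = s then q s / 2 else 0) + b s s' / 2 else b s s')" for s s'
  have D: "0 < D" using i by (simp add: D_def)
  have fin: "finite F" by (simp add: F_def faces_eq)
  have FK: "s \<in> K (Suc i)" "s \<in> X" if "s \<in> F" for s
    using that by (auto simp: F_def faces_eq)
  have q: "q s = D * w s" if "s \<in> F" for s
    using that walk_deg_eq by (simp add: F_def q_def D_def)
  have qpos: "0 < q s" if "s \<in> F" for s
    using q[OF that] w_face_pos[OF FK(2)[OF that]] D by simp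
  have bsum: "(\<Sum>s'\<in>F. b s s') = q s" if "s \<in> F" for s
    using row_sum[OF FK(1)[OF that]] q[OF that] sum_b_faces[of s "\<lambda>_. 1" i]
    by (simp add: F_def D_def)
  have sym: "c s s' = c s' s" if "s \<in> F" "s' \<in> F" for s s'
    using that b_sym[OF FK(1) FK(1)] by (auto simp: c_def)
  have row: "(\<Sum>s'\<in>F. c s s') = q s" if "s \<in> F" for s
    using that fin bsum[OF that]
    by (cases "i = 0") (simp_all add: c_def sum.distrib sum_divide_distrib[symmetric])
  have form: "\<bar>\<Sum>s\<in>F. \<Sum>s'\<in>F. c s s' * (f s * f s')\<bar> \<le> \<mu> * (\<Sum>s\<in>F. q s * (f s)\<^sup>2)"
    if mean: "(\<Sum>s\<in>F. q s * f s) = 0" for f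
  proof -
    define N where "N = D * sqnorm (Suc i) f"
    define B where "B = (\<Sum>s\<in>F. \<Sum>s'\<in>F. b s s' * (f s * f s'))"
    have N0: "0 \<le> N" using D sqnorm_nonneg by (simp add: N_def)
    have qF: "(\<Sum>s\<in>F. q s * g s) = D * (\<Sum>s\<in>K (Suc i). w s * g s)" for g
    proof -
      have "(\<Sum>s\<in>F. q s * g s) = D * (\<Sum>s\<in>F. w s * g s)"
        by (simp add: q sum_distrib_left mult.assoc cong: sum.cong)
      then show ?thesis by (simp add: F_def sum_w_faces)
    qed
    have N: "(\<Sum>s\<in>F. q s * (f s)\<^sup>2) = N" by (simp add: qF N_def sqnorm_def)
    have "B = (\<Sum>s\<in>F. \<Sum>s'\<in>K (Suc i). b s s' * (f s * f s'))"
      unfolding B_def F_def by (intro sum.cong[OF refl] sum_b_faces)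
    also have "\<dots> = (\<Sum>s\<in>K (Suc i). \<Sum>s'\<in>K (Suc i). b s s' * (f s * f s'))"
      using b_nonface by (intro sum.mono_neutral_left) (auto simp: F_def faces_eq)
    also have "\<dots> = N - energy (Suc i) f / 2"
      unfolding quadratic_form by (simp add: N_def D_def)
    finally have B: "B = N - energy (Suc i) f / 2" .
    have "(\<Sum>s\<in>K (Suc i). w s * f s) = 0" using mean D by (simp add: qF)
    from gap[OF this] have B_le: "B \<le> (1 - \<gamma>) * N"
      by (simp add: B N_def D_def algebra_simps)
    have "energy (Suc i) f / 2 \<le> (real i + 2) * (real d - real i) * sqnorm (Suc i) f"
      using energy_upper[of "Suc i" f] by (simp add: algebra_simps)
    also have "\<dots> = N + N / (real i + 1)"
      by (simp add: N_def D_def field_simps)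
    \<comment> \<open>For i = 0 this reads B \<ge> -N, and laziness lifts the form to a nonnegative
      one; for i \<ge> 1 the bound is covered by 1/2 \<le> \<mu>.\<close>
    finally have B_ge: "- (N / (real i + 1)) \<le> B" by (simp add: B)
    show ?thesis
    proof (cases "i = 0")
      case True
      have "(\<Sum>s\<in>F. \<Sum>s'\<in>F. c s s' * (f s * f s'))
          = (\<Sum>s\<in>F. \<Sum>s'\<in>F. (if s' = s then q s * (f s)\<^sup>2 / 2 else 0) + b s s' * (f s * f s') / 2)"
        using True by (intro sum.cong refl) (auto simp: c_def power2_eq_square algebra_simps)
      also have "\<dots> = N / 2 + B / 2"
        using fin by (simp add: sum.distrib sum_divide_distrib[symmetric] N B_def)
      finally have eq: "(\<Sum>s\<in>F. \<Sum>s'\<in>F. c s s' * (f s * f s')) = N / 2 + B / 2" .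
      have "N / 2 + B / 2 \<le> (1 - \<gamma> / 2) * N" using B_le by (simp add: algebra_simps)
      also have "\<dots> \<le> \<mu> * N" using \<gamma>(1)[OF True] N0 by (rule mult_right_mono)
      finally show ?thesis using B_ge True by (simp add: eq N)
    next
      case False
      then have eq: "(\<Sum>s\<in>F. \<Sum>s'\<in>F. c s s' * (f s * f s')) = B" by (simp add: c_def B_def)
      have "B \<le> \<mu> * N"
        using B_le mult_right_mono[OF \<gamma>(2)[OF False] N0] by linarith
      moreover have "1 / (real i + 1) \<le> 1 / 2" using False by simp
      then have "N / (real i + 1) \<le> \<mu> * N"
        using mult_right_mono[OF order.trans[OF _ \<mu>(1)] N0] by fastforce
      ultimately show ?thesis using B_ge by (simp add: eq N abs_le_iff)
    qed
  qed
  have "L2_set (\<lambda>s. walk_dist X (int i) p t s - stationary X (int i) s) F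
      \<le> sqrt (Max (q ` F) / Min (q ` F)) * \<mu> ^ t" if p: "distribution_on F p" for p t
    unfolding stationary_def F_def[symmetric] q_def[symmetric]
  proof (rule symmetric_kernel_mixing[OF fin sym row qpos _ form])
    show "0 < \<mu>" using \<mu> by simp
    show "distribution_on F (walk_dist X (int i) p 0)" using p by simp
    fix t s' assume s': "s' \<in> F"
    have "walk_prob X (int i) s s' = c s s' / q s" if s: "s \<in> F" for s
      using move_prob_eq[of s i s'] qpos[OF s] s s' unfolding F_def[symmetric] q_def[symmetric]
      by (cases "i = 0") (simp_all add: walk_prob_def c_def add_divide_distrib)
    then show "walk_dist X (int i) p (Suc t) s' = (\<Sum>s\<in>F. walk_dist X (int i) p t s * (c s s' / q s))"
      by (simp add: F_def)
  qed
  then show ?thesis using \<mu> by (simp add: rapidly_mixing_def F_def q_def)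
qed

lemma expander_gap:
  assumes ex: "skeleton_expander \<alpha> X" and \<alpha>: "\<alpha> < 1 / 2" and i: "i < d"
    and mean: "(\<Sum>s\<in>K (Suc i). w s * f s) = 0"
  shows "2 * ((1 / 2 - \<alpha>)\<^sup>2 / 2) ^ Suc i * (real d - real i) * sqnorm (Suc i) f \<le> energy (Suc i) f"
proof -
  have "0 < \<alpha>" using ex unfolding skeleton_expander_def by (rule conjunct1)
  then have "(1 / 2 - \<alpha>)\<^sup>2 \<le> 1" using \<alpha> by (intro power_le_one) auto
  show ?thesis
  proof (rule local_to_global_gap[OF _ _ _ i mean])
    show "(1 / 2 - \<alpha>)\<^sup>2 / 2 \<le> 1" using \<open>(1 / 2 - \<alpha>)\<^sup>2 \<le> 1\<close> by simp
    show "2 * ((1 / 2 - \<alpha>)\<^sup>2 / 2) * (real d - real k) * (\<Sum>s | s \<in> K (Suc k) \<and> r \<subseteq> s. w s * (f s - c)\<^sup>2)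
        \<le> (\<Sum>s | s \<in> K (Suc k) \<and> r \<subseteq> s. \<Sum>s' | s' \<in> K (Suc k) \<and> r \<subseteq> s'. b s s' * (f s - f s')\<^sup>2)"
      if "k < d" "r \<in> K k" "(\<Sum>s | s \<in> K (Suc k) \<and> r \<subseteq> s. w s * (f s - c)) = 0" for k r f c
      using expander_local_gap[OF ex \<alpha> that] by simp
  qed simp
qed

end

section \<open>Comparison with the claimed rate\<close>

text \<open>The index of the root is at least 4, and (5/4)^4 = 625/256 exceeds 2. This will bound
  both \<alpha> and the quantity \<epsilon> in the rate by 1/4.\<close>

lemma root_two_le:
  assumes "d > 1"
  shows "root (2 ^ d) 2 \<le> 5 / 4"
proof -
  have "(2::nat) ^ 2 \<le> 2 ^ d" using assms by (intro power_increasing) auto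
  then have "(4::nat) \<le> 2 ^ d" by simp
  then have "(5 / 4 :: real) ^ 4 \<le> (5 / 4) ^ (2 ^ d)" by (rule power_increasing) simp
  moreover have "(2::real) \<le> (5 / 4) ^ 4" by (simp add: power_divide)
  ultimately have "(2::real) \<le> (5 / 4) ^ (2 ^ d)" by linarith
  then have "root (2 ^ d) 2 \<le> root (2 ^ d) ((5 / 4) ^ (2 ^ d))"
    by (intro real_root_le_mono) auto
  also have "\<dots> = 5 / 4" by (rule real_root_power_cancel) auto
  finally show ?thesis .
qed

theorem theorem3p2:
  fixes V :: "'v set" and X :: "'v set set" and d :: nat and \<alpha> :: real
  assumes "d > 1"
    and "simplicial_complex V X"
    and "pure_complex X"
    and "complex_dim X = int d"
    and "skeleton_expander \<alpha> X"
    and "\<alpha> < (root (2 ^ d) 2 - 1) / sqrt 2"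
  shows "\<forall>i::nat. i < d \<longrightarrow>
    rapidly_mixing
      (1 - 1 / (2 * (real d + 1)\<^sup>2) *
         ((root (2 ^ d) 2 - 1 - sqrt 2 * \<alpha>) / (2 * sqrt 2 * real d)) ^ (2 * d))
      X (int i)"
proof (intro allI impI)
  fix i assume i: "i < d"
  interpret pure_simplicial_complex V X d
    using assms by unfold_locales
  define \<epsilon> where "\<epsilon> = root (2 ^ d) 2 - 1 - sqrt 2 * \<alpha>"
  define y where "y = (\<epsilon> / (2 * sqrt 2 * real d))\<^sup>2"
  define z where "z = (1 / 2 - \<alpha>)\<^sup>2 / 2"
  define \<tau> where "\<tau> = 1 / (2 * (real d + 1)\<^sup>2) * y ^ d"
  have \<alpha>0: "0 < \<alpha>" using assms(5) unfolding skeleton_expander_def by (rule conjunct1)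
  have \<epsilon>0: "0 < \<epsilon>" using assms(6) by (simp add: \<epsilon>_def field_simps)
  have "\<epsilon> + sqrt 2 * \<alpha> \<le> 1 / 4" using root_two_le[OF assms(1)] by (simp add: \<epsilon>_def)
  moreover have "1 * \<alpha> \<le> sqrt 2 * \<alpha>" using \<alpha>0 by (intro mult_right_mono) auto
  ultimately have \<epsilon>: "\<epsilon> \<le> 1 / 4" and \<alpha>: "\<alpha> \<le> 1 / 4" using \<epsilon>0 \<alpha>0 by linarith+
  have y0: "0 < y" using \<epsilon>0 assms(1) by (simp add: y_def)
  have z0: "0 < z" using \<alpha> by (simp add: z_def)
  have z1: "z \<le> 1" using \<alpha> \<alpha>0 power_le_one[of "1 / 2 - \<alpha>" 2] by (simp add: z_def)
  \<comment> \<open>Both are half a square, of \<epsilon> / (2 d) and of 1/2 - \<alpha>; the value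
    1/4 separates the two bases.\<close>
  have yz: "y \<le> z"
  proof -
    have "\<epsilon> / (2 * real d) \<le> 1 / 4 / 1"
      using \<epsilon> \<epsilon>0 assms(1) by (intro frac_le) auto
    then have "(\<epsilon> / (2 * real d))\<^sup>2 \<le> (1 / 2 - \<alpha>)\<^sup>2"
      using \<alpha> \<epsilon>0 by (intro power_mono) auto
    then show ?thesis by (simp add: y_def z_def power_divide power_mult_distrib)
  qed
  have yd: "y ^ d \<le> z ^ Suc i"
    using i y0 z0 z1 by (intro order.trans[OF power_mono[OF yz] power_decreasing]) auto
  have yd1: "y ^ d \<le> 1" using yz y0 z1 by (intro power_le_one) auto
  have yd0: "0 < y ^ d" using y0 by simp
  \<comment> \<open>The bound by 2 d absorbs the divisor i + 1 of the gap. The bound by 2 serves the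
    lazy case, where the gap is halved, and 1/2 \<le> 1 - \<tau>.\<close>
  have d2: "2 * real d \<le> 2 * (real d + 1)\<^sup>2" "2 \<le> 2 * (real d + 1)\<^sup>2"
    by (auto simp: power2_eq_square algebra_simps)
  have \<tau>0: "0 < \<tau>" using yd0 by (simp add: \<tau>_def)
  have \<tau>_eq: "\<tau> = y ^ d / (2 * (real d + 1)\<^sup>2)" by (simp add: \<tau>_def)
  have \<tau>2: "\<tau> \<le> y ^ d / 2"
    unfolding \<tau>_eq using d2(2) yd0 by (intro frac_le) simp_all
  have \<tau>d: "\<tau> \<le> y ^ d / (2 * real d)"
    unfolding \<tau>_eq using d2(1) yd0 assms(1) by (intro frac_le) simp_all
  have "rapidly_mixing (1 - \<tau>) X (int i)"
  proof (rule rapidly_mixing_if_gap[OF i, where \<gamma> = "z ^ Suc i / (real i + 1)"])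
    show "1 / 2 \<le> 1 - \<tau>" "1 - \<tau> < 1" using \<tau>2 \<tau>0 yd1 by auto
    show "2 * (z ^ Suc i / (real i + 1)) * ((real i + 1) * (real d - real i) * sqnorm (Suc i) f)
        \<le> energy (Suc i) f" if "(\<Sum>s\<in>K (Suc i). w s * f s) = 0" for f
    proof -
      have cancel: "2 * (a / (real i + 1)) * ((real i + 1) * e * g) = 2 * a * e * g" for a e g
        by (simp add: field_simps)
      show ?thesis
        unfolding cancel z_def using \<alpha> by (intro expander_gap assms(5) i that) simp
    qed
    show "1 - z ^ Suc i / (real i + 1) / 2 \<le> 1 - \<tau>" if "i = 0"
      using that \<tau>2 yd by simp
    have "y ^ d / (2 * real d) \<le> z ^ Suc i / (real i + 1)"
      using yd yd0 i by (intro frac_le) auto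
    then show "1 - z ^ Suc i / (real i + 1) \<le> 1 - \<tau>" using \<tau>d by simp
  qed
  then show "rapidly_mixing
      (1 - 1 / (2 * (real d + 1)\<^sup>2) *
         ((root (2 ^ d) 2 - 1 - sqrt 2 * \<alpha>) / (2 * sqrt 2 * real d)) ^ (2 * d))
      X (int i)"
    by (simp add: \<tau>_def y_def \<epsilon>_def power_mult)
qed

end
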